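(* Let $\mathbb{G}=(\mathbb{R}^{m+n},\cdot,\delta_\lambda)$ be a Carnot group of step $2$ with complementary subgroups $\mathbb{V}=\{(x_1,0,\dots,0)\}$ and $\mathbb{W}=\{(0,x_2,\dots,x_m,y_1,\dots,y_n)\}$. Let $\hat{\mathcal O}\subset\mathbb{W}$ be open, let $\hat\phi:\hat{\mathcal O}\to\mathbb{V}$ be a continuous map, and let $\phi:\mathcal O\to\mathbb{R}$ be the real-valued function associated to $\hat\phi$. Assume that (1) $\phi$ is a continuous distributional solution of $(D^\phi_2\phi,\dots,D^\phi_m\phi)=w$ in $\mathcal O$ with $w\in\mathcal L^\infty_{loc}(\mathcal O,\mathbb R^{m-1})$; (2) $\phi$ is locally $1/2$-H\"older continuous along the vertical components with H\"older constant $C_h>0$. Then $\hat\phi$ is a locally intrinsic Lipschitz function.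
   Context: Group. $\mathcal B^{(s)}=(b^{(s)}_{jl})_{j,l=1}^m$, $s=1,\dots,n$, are linearly independent skew-symmetric real $m\times m$ matrices. $\mathbb{G}=\mathbb{R}^{m+n}$, with points $p=(p^1,p^2)\in\mathbb{R}^m\times\mathbb{R}^n$ also written $(x_1,\dots,x_m,y_1,\dots,y_n)$, has the product $p\cdot q=(p^1+q^1,\,p^2+q^2+\tfrac12\langle\mathcal Bp^1,q^1\rangle)$, $\langle\mathcal Bp^1,q^1\rangle=(\langle\mathcal B^{(1)}p^1,q^1\rangle,\dots,\langle\mathcal B^{(n)}p^1,q^1\rangle)$, and dilations $\delta_\lambda p=(\lambda p^1,\lambda^2p^2)$. The homogeneous norm is $\|p\|=\max\{|p^1|,\epsilon|p^2|^{1/2}\}$ with $\epsilon\in(0,1]$ fixed so that $\|p\cdot q\|\le\|p\|+\|q\|$. Each $p\in\mathbb{G}$ is uniquely $p=p_{\mathbb W}\cdot p_{\mathbb V}$ with $p_{\mathbb W}\in\mathbb W$, $p_{\mathbb V}\in\mathbb V$. Let $i:\mathbb{R}^{m+n-1}\to\mathbb W$, $i(x_2,\dots,x_m,y_1,\dots,y_n)=(0,x_2,\dots,x_m,y_1,\dots,y_n)$. Given $\hat\phi:\hat{\mathcal O}\to\mathbb V$, put $\mathcal O=i^{-1}(\hat{\mathcal O})$, and $\phi:\mathcal O\to\mathbb R$ is defined by $\hat\phi(i(a))=(\phi(a),0,\dots,0)$. Points of $\mathcal O$ are written $(x,y)$ with $x=(x_2,\dots,x_m)$, $y=(y_1,\dots,y_n)$.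 The intrinsic graph is $\mathrm{graph}(\hat\phi)=\{a\cdot\hat\phi(a):a\in\hat{\mathcal O}\}$. Intrinsic Lipschitz. For $\beta\ge0$, $q\in\mathbb G$ let $C_{\mathbb W,\mathbb V}(q,\beta)=q\cdot\{p:\|p_{\mathbb W}\|\le\beta\|p_{\mathbb V}\|\}$. $\hat\phi$ is intrinsic $C_L$-Lipschitz ($C_L\ge0$) if for all $C_1>C_L$ and all $p\in\mathrm{graph}(\hat\phi)$, $C_{\mathbb W,\mathbb V}(p,1/C_1)\cap\mathrm{graph}(\hat\phi)=\{p\}$; it is intrinsic Lipschitz if this holds for some $C_L$, and locally intrinsic Lipschitz if every point of $\hat{\mathcal O}$ has a neighbourhood on which the restriction of $\hat\phi$ is intrinsic Lipschitz. Distributional solution. On functions on $\mathcal O$ let $X_j=\partial_{x_j}+\tfrac12\sum_{s=1}^n\sum_{l=2}^m b_{jl}^{(s)}x_l\,\partial_{y_s}$ for $j=2,\dots,m$ and $Y_s=\partial_{y_s}$. For $w=(w_2,\dots,w_m)\in\mathcal L^\infty_{loc}(\mathcal O,\mathbb R^{m-1})$, a continuous $\phi:\mathcal O\to\mathbb R$ is a distributional solution of $(D_2^\phi\phi,\dots,D_m^\phi\phi)=w$ in $\mathcal O$ if for all $\zeta\in C^1_c(\mathcal O,\mathbb R)$ and $j=2,\dots,m$, $$\int_{\mathcal O}\phi\Big(X_j\zeta+\tfrac12\phi\sum_{s=1}^n b_{j1}^{(s)}Y_s\zeta\Big)d\mathcal L^{m+n-1}=-\int_{\mathcal O}w_j\zeta\,d\mathcal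 L^{m+n-1}.$$ Vertical H\"older continuity. $\phi$ is locally $1/2$-H\"older continuous along the vertical components with constant $C_h$ if every point of $\mathcal O$ has a neighbourhood $\mathcal O'\subset\mathcal O$ with $|\phi(x,y)-\phi(x,y')|\le C_h|y-y'|_{\mathbb R^n}^{1/2}$ for all $(x,y),(x,y')\in\mathcal O'$. *)

theory Defs
  imports "HOL-Analysis.Analysis"
begin

text \<open>
  The horizontal coordinates \<open>x\<^sub>1, \<dots>, x\<^sub>m\<close> are indexed by \<open>'k option\<close>: the index \<open>None\<close> is the
  distinguished first coordinate and \<open>Some j\<close>, \<open>j :: 'k\<close>, are the coordinates 2 to \<open>m\<close>, so that
  \<open>m = CARD('k) + 1\<close>. The vertical coordinates \<open>y\<^sub>1, \<dots>, y\<^sub>n\<close> are indexed by \<open>'n\<close>, so that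
  \<open>n = CARD('n)\<close>. That \<open>m \<ge> 2\<close> is no restriction: for \<open>m = 1\<close> the only skew-symmetric
  matrix is 0. The entry \<open>b\<^sub>j\<^sub>l\<close> of the \<open>s\<close>-th matrix is \<open>B s $ j $ l\<close>.
\<close>

type_synonym ('k, 'n) pt = "(real ^ 'k option) \<times> (real ^ 'n)"

type_synonym ('k, 'n) param = "(real ^ 'k) \<times> (real ^ 'n)"

type_synonym ('k, 'n) structure_mats = "'n \<Rightarrow> real ^ 'k option ^ 'k option"

definition step2_structure :: "('k::finite, 'n::finite) structure_mats \<Rightarrow> bool" where
  "step2_structure B \<longleftrightarrow>
     (\<forall>s. transpose (B s) = - B s) \<and> inj B \<and> independent (range B)"

definition gmult ::
    "('k::finite, 'n::finite) structure_mats \<Rightarrow> ('k, 'n) pt \<Rightarrow> ('k, 'n) pt \<Rightarrow> ('k, 'n) pt" where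
  "gmult B p q =
     (fst p + fst q, snd p + snd q + (1/2) *\<^sub>R (\<chi> s. (B s *v fst p) \<bullet> fst q))"

definition hnorm :: "real \<Rightarrow> ('k::finite, 'n::finite) pt \<Rightarrow> real" where
  "hnorm \<epsilon> p = max (norm (fst p)) (\<epsilon> * sqrt (norm (snd p)))"

definition hnorm_const :: "('k::finite, 'n::finite) structure_mats \<Rightarrow> real \<Rightarrow> bool" where
  "hnorm_const B \<epsilon> \<longleftrightarrow> 0 < \<epsilon> \<and> \<epsilon> \<le> 1 \<and>
     (\<forall>p q. hnorm \<epsilon> (gmult B p q) \<le> hnorm \<epsilon> p + hnorm \<epsilon> q)"

definition emb_V :: "real \<Rightarrow> ('k::finite, 'n::finite) pt" where
  "emb_V t = (axis None t, 0)"

definition emb_W :: "('k::finite, 'n::finite) param \<Rightarrow> ('k, 'n) pt" where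
  "emb_W a = ((\<chi> j. case j of None \<Rightarrow> 0 | Some l \<Rightarrow> fst a $ l), snd a)"

definition VV :: "('k::finite, 'n::finite) pt set" where
  "VV = range emb_V"

definition WW :: "('k::finite, 'n::finite) pt set" where
  "WW = range emb_W"

definition proj_W ::
    "('k::finite, 'n::finite) structure_mats \<Rightarrow> ('k, 'n) pt \<Rightarrow> ('k, 'n) pt" where
  "proj_W B p = (THE u. u \<in> WW \<and> (\<exists>v\<in>VV. p = gmult B u v))"

definition proj_V ::
    "('k::finite, 'n::finite) structure_mats \<Rightarrow> ('k, 'n) pt \<Rightarrow> ('k, 'n) pt" where
  "proj_V B p = (THE v. v \<in> VV \<and> (\<exists>u\<in>WW. p = gmult B u v))"

lemma WW_iff: "p \<in> WW \<longleftrightarrow> fst p $ None = 0"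
proof
  assume "fst p $ None = 0"
  then have "p = emb_W ((\<chi> l. fst p $ Some l), snd p)"
    by (auto simp: emb_W_def prod_eq_iff vec_eq_iff split: option.split)
  then show "p \<in> WW" unfolding WW_def by blast
qed (auto simp: WW_def emb_W_def)

lemma gmult_WV_cancel:
  fixes B :: "('k::finite, 'n::finite) structure_mats"
  assumes "u \<in> WW" "u' \<in> WW" "v \<in> VV" "v' \<in> VV" "gmult B u v = gmult B u' v'"
  shows "u = u'" "v = v'"
proof -
  obtain t t' where t: "v = emb_V t" "v' = emb_V t'"
    using assms(3,4) by (auto simp: VV_def)
  have 1: "fst u + axis None t = fst u' + axis None t'"
    using assms(5) by (simp add: gmult_def t emb_V_def)
  then have "(fst u + axis None t) $ None = (fst u' + axis None t') $ None" by simp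
  then have tt: "t = t'" using assms(1,2) by (simp add: WW_iff axis_def)
  then have "fst u = fst u'" using 1 by simp
  moreover from this tt have "snd u = snd u'"
    using assms(5) by (simp add: gmult_def t emb_V_def)
  ultimately show "u = u'" by (simp add: prod_eq_iff)
  show "v = v'" using t tt by simp
qed

text \<open>The decomposition behind \<^const>\<open>proj_W\<close> and \<^const>\<open>proj_V\<close> exists and is unique.\<close>

lemma decomposition_exists:
  fixes B :: "('k::finite, 'n::finite) structure_mats"
  shows "\<exists>u\<in>WW. \<exists>v\<in>VV. p = gmult B u v"
proof -
  define v :: "('k, 'n) pt" where "v = emb_V (fst p $ None)"
  define x where "x = fst p - fst v"
  define u where "u = (x, snd p - (1/2) *\<^sub>R (\<chi> s. (B s *v x) \<bullet> fst v))"
  have "u \<in> WW" by (simp add: WW_iff u_def x_def v_def emb_V_def)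
  moreover have "v \<in> VV" by (simp add: VV_def v_def)
  moreover have "p = gmult B u v"
    by (simp add: gmult_def u_def x_def) (simp add: v_def emb_V_def)
  ultimately show ?thesis by blast
qed

lemma proj_W_V:
  fixes B :: "('k::finite, 'n::finite) structure_mats"
  assumes "u \<in> WW" "v \<in> VV"
  shows "proj_W B (gmult B u v) = u" "proj_V B (gmult B u v) = v"
  unfolding proj_W_def proj_V_def
  by (rule the_equality; use assms gmult_WV_cancel in blast)+

definition igraph ::
    "('k::finite, 'n::finite) structure_mats \<Rightarrow> ('k, 'n) pt set
      \<Rightarrow> (('k, 'n) pt \<Rightarrow> ('k, 'n) pt) \<Rightarrow> ('k, 'n) pt set" where
  "igraph B A f = {gmult B a (f a) | a. a \<in> A}"

definition icone ::
    "('k::finite, 'n::finite) structure_mats \<Rightarrow> real \<Rightarrow> ('k, 'n) pt \<Rightarrow> real \<Rightarrow> ('k, 'n) pt set" where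
  "icone B \<epsilon> q \<beta> = gmult B q ` {p. hnorm \<epsilon> (proj_W B p) \<le> \<beta> * hnorm \<epsilon> (proj_V B p)}"

definition intrinsic_lipschitz_with ::
    "('k::finite, 'n::finite) structure_mats \<Rightarrow> real \<Rightarrow> real \<Rightarrow> ('k, 'n) pt set
      \<Rightarrow> (('k, 'n) pt \<Rightarrow> ('k, 'n) pt) \<Rightarrow> bool" where
  "intrinsic_lipschitz_with B \<epsilon> L A f \<longleftrightarrow> 0 \<le> L \<and>
     (\<forall>C > L. \<forall>p \<in> igraph B A f. icone B \<epsilon> p (1 / C) \<inter> igraph B A f = {p})"

definition locally_intrinsic_lipschitz ::
    "('k::finite, 'n::finite) structure_mats \<Rightarrow> real \<Rightarrow> ('k, 'n) pt set
      \<Rightarrow> (('k, 'n) pt \<Rightarrow> ('k, 'n) pt) \<Rightarrow> bool" where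
  "locally_intrinsic_lipschitz B \<epsilon> A f \<longleftrightarrow>
     (\<forall>a\<in>A. \<exists>U. openin (top_of_set A) U \<and> a \<in> U \<and>
        (\<exists>L. intrinsic_lipschitz_with B \<epsilon> L U f))"

text \<open>
  A test function is extended by 0 to the whole parameter space; \<open>D\<close> is its (continuous) Frechet
  derivative.
\<close>

definition C1c :: "('a::euclidean_space) set \<Rightarrow> ('a \<Rightarrow> real) set" where
  "C1c S = {\<zeta>. (\<exists>D :: 'a \<Rightarrow> 'a \<Rightarrow>\<^sub>L real. continuous_on UNIV D \<and>
                  (\<forall>a. (\<zeta> has_derivative blinfun_apply (D a)) (at a))) \<and>
               compact (closure {a. \<zeta> a \<noteq> 0}) \<and> closure {a. \<zeta> a \<noteq> 0} \<subseteq> S}"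

text \<open>
  The operators are only applied to differentiable functions, where the Frechet derivative
  evaluated at a coordinate vector is the partial derivative.
\<close>

definition Yop :: "'n \<Rightarrow> (('k::finite, 'n::finite) param \<Rightarrow> real) \<Rightarrow> ('k, 'n) param \<Rightarrow> real" where
  "Yop s \<zeta> a = frechet_derivative \<zeta> (at a) (0, axis s 1)"

definition Xop ::
    "('k::finite, 'n::finite) structure_mats \<Rightarrow> 'k \<Rightarrow> (('k, 'n) param \<Rightarrow> real)
      \<Rightarrow> ('k, 'n) param \<Rightarrow> real" where
  "Xop B j \<zeta> a = frechet_derivative \<zeta> (at a) (axis j 1, 0) +
     1/2 * (\<Sum>s\<in>UNIV. \<Sum>l\<in>UNIV. B s $ Some j $ Some l * fst a $ l * Yop s \<zeta> a)"

definition Linf_loc :: "('a::euclidean_space) set \<Rightarrow> ('a \<Rightarrow> 'b::euclidean_space) set" where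
  "Linf_loc S = {w. w \<in> borel_measurable (lebesgue_on S) \<and>
     (\<forall>K. compact K \<and> K \<subseteq> S \<longrightarrow> (\<exists>M. AE a in lebesgue. a \<in> K \<longrightarrow> norm (w a) \<le> M))}"

definition distributional_solution ::
    "('k::finite, 'n::finite) structure_mats \<Rightarrow> ('k, 'n) param set
      \<Rightarrow> (('k, 'n) param \<Rightarrow> real) \<Rightarrow> (('k, 'n) param \<Rightarrow> real ^ 'k) \<Rightarrow> bool" where
  "distributional_solution B S \<phi> w \<longleftrightarrow> continuous_on S \<phi> \<and>
     (\<forall>\<zeta> \<in> C1c S. \<forall>j.
        (LINT a:S|lebesgue. \<phi> a * (Xop B j \<zeta> a +
            1/2 * \<phi> a * (\<Sum>s\<in>UNIV. B s $ Some j $ None * Yop s \<zeta> a)))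
        = - (LINT a:S|lebesgue. w a $ j * \<zeta> a))"

definition vertically_half_hoelder ::
    "real \<Rightarrow> ('k::finite, 'n::finite) param set \<Rightarrow> (('k, 'n) param \<Rightarrow> real) \<Rightarrow> bool" where
  "vertically_half_hoelder C S \<phi> \<longleftrightarrow>
     (\<forall>a\<in>S. \<exists>U. open U \<and> a \<in> U \<and> U \<subseteq> S \<and>
        (\<forall>x y y'. (x, y) \<in> U \<longrightarrow> (x, y') \<in> U \<longrightarrow>
           \<bar>\<phi> (x, y) - \<phi> (x, y')\<bar> \<le> C * sqrt (norm (y - y'))))"

end

theory Submission
  imports Defs
begin

text \<open>
  Let \<open>\<xi>\<close> be the difference of the \<open>x\<close>-coordinates of two parameter points \<open>a\<close> and \<open>a'\<close>. Computing the
  group increment between the graph points over them shows that the cone condition follows from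
  \<open>\<bar>\<phi> a' - \<phi> a\<bar> \<le> L * max (norm \<xi>) (\<epsilon> * sqrt (norm v))\<close>, where \<open>v\<close> is the vertical distance from \<open>a'\<close> to
  \<open>a + Z\<close> and \<open>Z = (\<xi>, (1/2) *\<^sub>R hform B (fst a) \<xi> + \<phi> a *\<^sub>R coupling B \<xi>)\<close> is the direction of the operator
  \<open>\<Sum>j. \<xi> $ j * D\<^sub>j\<^sup>\<phi>\<close> with the coefficient \<open>\<phi>\<close> frozen at \<open>a\<close> (\<open>gmult_intrinsic_disp\<close>,
  \<open>intrinsic_lipschitz_criterion\<close>). Vertical Hoelder continuity takes care of the step from \<open>a + Z\<close> to
  \<open>a'\<close>, and what has to be shown is \<open>\<bar>\<phi> (a + Z) - \<phi> a\<bar> \<le> L * norm \<xi>\<close>.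

  This is \<open>characteristic_estimate\<close>. Along \<open>Z\<close> the equation is a Burgers equation with bounded source,
  and \<open>\<phi> - \<phi> a\<close> is transported up to the flux of \<open>(\<phi> - \<phi> a)\<^sup>2 / 2\<close>. Test it with a bump that is moved
  along the segment from \<open>a\<close> to \<open>a + Z\<close> and has vertical width \<open>r\<close>. By Hoelder continuity \<open>\<phi>\<close> oscillates
  by at most a multiple of \<open>sqrt r\<close> on the bump, so with \<open>G\<close> the maximum of \<open>\<bar>\<phi> - \<phi> a\<bar>\<close> on the segment the
  flux through the bump is at most a multiple of \<open>norm \<xi> * sqrt r * (G + sqrt r) / r\<close>, and averages
  differ from values by a multiple of \<open>sqrt r\<close>. For \<open>r\<close> equal to a large multiple of \<open>(norm \<xi>)\<^sup>2\<close>, which is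
  the homogeneous scaling of the group, the flux is at most \<open>G / 2\<close> plus a multiple of \<open>norm \<xi>\<close>, and
  so \<open>G\<close> itself is at most a multiple of \<open>norm \<xi>\<close>.
\<close>

section \<open>Anisotropic bump functions\<close>

text \<open>
  The test functions are the squares of the positive part of \<open>level\<close>, a concave quadratic
  polynomial that is positive on an ellipsoid with horizontal half-axes \<open>\<delta>\<close> and vertical half-axes
  \<open>r\<close>. Squaring the positive part is enough for continuous differentiability, and the explicit
  gradient makes all estimates elementary. The two radii are independent because the vertical one is
  fixed by the scaling of the problem, while the horizontal one may shrink as far as an error
  estimate requires.
\<close>

definition level :: "real \<Rightarrow> real \<Rightarrow> 'a::euclidean_space \<times> 'b::euclidean_space \<Rightarrow> real" where
  "level \<delta> r z = 1 - (fst z \<bullet> fst z) / \<delta>\<^sup>2 - (snd z \<bullet> snd z) / r\<^sup>2"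

definition bump :: "real \<Rightarrow> real \<Rightarrow> 'a::euclidean_space \<times> 'b::euclidean_space \<Rightarrow> real" where
  "bump \<delta> r z = (max 0 (level \<delta> r z))\<^sup>2"

definition bump_grad ::
    "real \<Rightarrow> real \<Rightarrow> 'a::euclidean_space \<times> 'b::euclidean_space \<Rightarrow> 'a \<times> 'b" where
  "bump_grad \<delta> r z =
     (- 4 * max 0 (level \<delta> r z)) *\<^sub>R ((1 / \<delta>\<^sup>2) *\<^sub>R fst z, (1 / r\<^sup>2) *\<^sub>R snd z)"

lemma has_real_derivative_square_pos_part:
  "((\<lambda>x::real. (max 0 x)\<^sup>2) has_real_derivative 2 * max 0 x) (at x)"
proof (cases x "0::real" rule: linorder_cases)
  case less
  have "((\<lambda>x::real. 0) has_real_derivative 2 * max 0 x) (at x)" using less by simp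
  then show ?thesis
    by (rule has_field_derivative_transform_within_open[of _ _ _ "{..<0}"]) (use less in auto)
next
  case greater
  have "((\<lambda>x::real. x\<^sup>2) has_real_derivative 2 * max 0 x) (at x)"
    using greater by (auto intro!: derivative_eq_intros)
  then show ?thesis
    by (rule has_field_derivative_transform_within_open[of _ _ _ "{0<..}"]) (use greater in auto)
next
  case equal
  have "((\<lambda>h. ((max 0 (0 + h))\<^sup>2 - (max 0 0)\<^sup>2) / h) \<longlongrightarrow> (0::real)) (at 0)"
  proof (rule Lim_null_comparison)
    show "\<forall>\<^sub>F h in at 0. norm (((max 0 (0 + h))\<^sup>2 - (max 0 0)\<^sup>2) / h) \<le> \<bar>h::real\<bar>"
      by (rule always_eventually) (auto simp: max_def power2_eq_square)
    show "((\<lambda>h::real. \<bar>h\<bar>) \<longlongrightarrow> 0) (at 0)" by (rule tendsto_rabs_zero) simp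
  qed
  then show ?thesis using equal by (simp add: DERIV_def)
qed

lemma bump_has_derivative:
  "(bump \<delta> r has_derivative (\<lambda>h. bump_grad \<delta> r z \<bullet> h)) (at z)"
proof -
  have 1: "(level \<delta> r has_derivative
      (\<lambda>h. - (2 * (fst z \<bullet> fst h) / \<delta>\<^sup>2) - 2 * (snd z \<bullet> snd h) / r\<^sup>2)) (at z)"
    unfolding level_def divide_inverse
    by (auto intro!: derivative_eq_intros simp: inner_commute fun_eq_iff algebra_simps)
  have 2: "((\<lambda>x::real. (max 0 x)\<^sup>2) has_derivative (*) (2 * max 0 (level \<delta> r z)))
      (at (level \<delta> r z))"
    using has_real_derivative_square_pos_part by (simp add: has_field_derivative_def)
  show ?thesis
    unfolding bump_def
    by (rule has_derivative_eq_rhs[OF has_derivative_compose[OF 1 2]])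
       (auto simp: bump_grad_def inner_prod_def fun_eq_iff algebra_simps)
qed

lemma continuous_on_level [continuous_intros]:
  "continuous_on S f \<Longrightarrow> continuous_on S (\<lambda>x. level \<delta> r (f x))"
  unfolding level_def divide_inverse by (intro continuous_intros)

lemma continuous_on_bump [continuous_intros]:
  "continuous_on S f \<Longrightarrow> continuous_on S (\<lambda>x. bump \<delta> r (f x))"
  unfolding bump_def by (intro continuous_intros)

lemma continuous_on_bump_grad [continuous_intros]:
  "continuous_on S f \<Longrightarrow> continuous_on S (\<lambda>x. bump_grad \<delta> r (f x))"
  unfolding bump_grad_def by (intro continuous_intros)

lemma bump_nonneg [simp]: "0 \<le> bump \<delta> r z"
  by (simp add: bump_def)

lemma level_pos_imp:
  assumes "0 < level \<delta> r z" "0 < \<delta>" "0 < r"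
  shows "norm (fst z) < \<delta>" "norm (snd z) < r"
proof -
  have p: "0 \<le> (fst z \<bullet> fst z) / \<delta>\<^sup>2" "0 \<le> (snd z \<bullet> snd z) / r\<^sup>2" by simp_all
  have "(fst z \<bullet> fst z) / \<delta>\<^sup>2 < 1" using assms(1) p unfolding level_def by linarith
  then have "(norm (fst z))\<^sup>2 < \<delta>\<^sup>2"
    using assms by (simp add: power2_norm_eq_inner)
  then show "norm (fst z) < \<delta>" using assms power2_less_imp_less by force
  have "(snd z \<bullet> snd z) / r\<^sup>2 < 1" using assms(1) p unfolding level_def by linarith
  then have "(norm (snd z))\<^sup>2 < r\<^sup>2"
    using assms by (simp add: power2_norm_eq_inner)
  then show "norm (snd z) < r" using assms power2_less_imp_less by force
qed

lemma bump_support: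
  assumes "bump \<delta> r z \<noteq> 0 \<or> bump_grad \<delta> r z \<noteq> 0" "0 < \<delta>" "0 < r"
  shows "norm (fst z) < \<delta>" "norm (snd z) < r"
proof -
  have "0 < level \<delta> r z"
    using assms(1) by (rule contrapos_pp) (simp add: bump_def bump_grad_def max_def zero_prod_def)
  from level_pos_imp[OF this assms(2,3)] show "norm (fst z) < \<delta>" "norm (snd z) < r" by auto
qed

text \<open>
  A bound of the gradient by the bump itself fails near the boundary of the support. On that support,
  however, the bump dilated by the factor 2 is at least \<open>(3/4)\<^sup>2\<close>, so it dominates the vertical
  gradient up to the factor \<open>8 / r\<close>; its integral differs from that of the bump only by a power of 2.
\<close>

lemma norm_snd_bump_grad_le:
  assumes "0 < \<delta>" "0 < r"
  shows "norm (snd (bump_grad \<delta> r z)) \<le> (8 / r) * bump \<delta> r ((1/2) *\<^sub>R z)"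
proof (cases "0 < level \<delta> r z")
  case True
  have p: "0 \<le> (fst z \<bullet> fst z) / \<delta>\<^sup>2" "0 \<le> (snd z \<bullet> snd z) / r\<^sup>2" by simp_all
  have l1: "level \<delta> r z \<le> 1" using p unfolding level_def by linarith
  have "level \<delta> r ((1/2) *\<^sub>R z) = 3/4 + level \<delta> r z / 4"
    by (simp add: level_def field_simps)
  then have "3/4 \<le> level \<delta> r ((1/2) *\<^sub>R z)" using True by simp
  then have "(3/4)\<^sup>2 \<le> bump \<delta> r ((1/2) *\<^sub>R z)"
    unfolding bump_def by (intro power_mono) auto
  then have b: "1/2 \<le> bump \<delta> r ((1/2) *\<^sub>R z)" by (simp add: power2_eq_square)
  have "norm (snd (bump_grad \<delta> r z)) = 4 * level \<delta> r z * (norm (snd z) / r\<^sup>2)"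
    using True assms by (simp add: bump_grad_def)
  also have "\<dots> \<le> 4 * 1 * (r / r\<^sup>2)"
    using l1 True level_pos_imp[OF True assms]
    by (intro mult_mono divide_right_mono) auto
  also have "\<dots> = (8 / r) * (1/2)" using assms by (simp add: power2_eq_square)
  also have "\<dots> \<le> (8 / r) * bump \<delta> r ((1/2) *\<^sub>R z)"
    using b assms by (intro mult_left_mono) auto
  finally show ?thesis .
next
  case False
  then have "bump_grad \<delta> r z = 0" by (simp add: bump_grad_def max_def zero_prod_def)
  then show ?thesis using assms by simp
qed

lemma has_integral_on_support:
  fixes f :: "'a::euclidean_space \<Rightarrow> 'b::banach"
  assumes "(f has_integral i) UNIV" "\<And>x. f x \<noteq> 0 \<Longrightarrow> x \<in> S"
  shows "(f has_integral i) S"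
proof -
  have "(\<lambda>x. if x \<in> S then f x else 0) = f" using assms(2) by (auto simp: fun_eq_iff)
  then show ?thesis using assms(1) has_integral_restrict_UNIV[of S f i] by simp
qed

text \<open>
  Substitution on the whole space, for functions of bounded support. It serves three times: with
  \<open>m = 1\<close> to translate a bump, with \<open>m = 1/2\<close> to dilate it, and with \<open>m = -1\<close> to see that the
  gradient, an odd function, has integral 0.
\<close>

lemma has_integral_affinity_UNIV:
  fixes f :: "'a::euclidean_space \<Rightarrow> 'b::banach"
  assumes "(f has_integral i) UNIV" "\<And>x. f x \<noteq> 0 \<Longrightarrow> x \<in> cbox u v" "m \<noteq> 0"
  shows "((\<lambda>x. f (m *\<^sub>R x + c)) has_integral (1 / \<bar>m\<bar> ^ DIM('a)) *\<^sub>R i) UNIV"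
proof -
  have "(f has_integral i) (cbox u v)"
    by (rule has_integral_on_support[OF assms(1,2)])
  from has_integral_affinity[OF this assms(3), of c]
  have *: "((\<lambda>x. f (m *\<^sub>R x + c)) has_integral (1 / \<bar>m\<bar> ^ DIM('a)) *\<^sub>R i)
      ((\<lambda>x. (1 / m) *\<^sub>R x + - ((1 / m) *\<^sub>R c)) ` cbox u v)" .
  show ?thesis
  proof (rule has_integral_on_superset[OF *])
    fix x
    assume n: "x \<notin> (\<lambda>x. (1 / m) *\<^sub>R x + - ((1 / m) *\<^sub>R c)) ` cbox u v"
    show "f (m *\<^sub>R x + c) = 0"
    proof (rule ccontr)
      assume "f (m *\<^sub>R x + c) \<noteq> 0"
      then have "m *\<^sub>R x + c \<in> cbox u v" using assms(2) by blast
      moreover have "x = (1 / m) *\<^sub>R (m *\<^sub>R x + c) + - ((1 / m) *\<^sub>R c)"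
        using assms(3) by (simp add: scaleR_add_right)
      ultimately show False using n by blast
    qed
  qed auto
qed

text \<open>
  The mass is a function of the radii alone, so the underlying space enters as a type argument.
\<close>

definition bump_mass :: "('a::euclidean_space \<times> 'b::euclidean_space) itself \<Rightarrow> real \<Rightarrow> real \<Rightarrow> real" where
  "bump_mass _ \<delta> r = integral UNIV (bump \<delta> r :: 'a \<times> 'b \<Rightarrow> real)"

lemma cylinder_in_cbox:
  obtains u v :: "'a::euclidean_space \<times> 'b::euclidean_space"
  where "\<And>z. norm (fst z) \<le> \<delta> \<Longrightarrow> norm (snd z) \<le> r \<Longrightarrow> z \<in> cbox u v"
proof -
  have "bounded (cball (0::'a) \<delta> \<times> cball (0::'b) r)" by (intro bounded_Times bounded_cball)
  then obtain w where w: "cball (0::'a) \<delta> \<times> cball (0::'b) r \<subseteq> cbox (-w) w"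
    using bounded_subset_cbox_symmetric by blast
  show thesis
  proof (rule that[of "-w" w])
    fix z :: "'a \<times> 'b"
    assume "norm (fst z) \<le> \<delta>" "norm (snd z) \<le> r"
    then show "z \<in> cbox (-w) w" using w by (cases z) auto
  qed
qed

lemma has_integral_UNIV_compact_support:
  fixes f :: "'a::euclidean_space \<Rightarrow> 'b::banach"
  assumes "continuous_on UNIV f" "\<And>x. f x \<noteq> 0 \<Longrightarrow> x \<in> cbox u v"
  shows "(f has_integral integral UNIV f) UNIV"
proof -
  have "f integrable_on cbox u v"
    by (rule integrable_continuous) (use assms(1) continuous_on_subset in blast)
  then have "f integrable_on UNIV"
    by (rule integrable_on_superset) (use assms(2) in auto)
  then show ?thesis by (rule integrable_integral)
qed

lemma has_integral_bump:
  assumes "0 < \<delta>" "0 < r"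
  shows "(bump \<delta> r has_integral bump_mass TYPE('a::euclidean_space \<times> 'b::euclidean_space) \<delta> r)
    (UNIV :: ('a \<times> 'b) set)"
proof -
  obtain u v :: "'a \<times> 'b" where
    uv: "\<And>z. norm (fst z) \<le> \<delta> \<Longrightarrow> norm (snd z) \<le> r \<Longrightarrow> z \<in> cbox u v"
    using cylinder_in_cbox[of \<delta> r] by blast
  show ?thesis
    unfolding bump_mass_def
    by (rule has_integral_UNIV_compact_support[of _ u v])
       (use bump_support(1,2)[of \<delta> r, OF disjI1 assms] in \<open>auto intro!: continuous_intros uv less_imp_le\<close>)
qed

lemma has_integral_bump_affine:
  fixes c :: "'a::euclidean_space \<times> 'b::euclidean_space"
  assumes "0 < \<delta>" "0 < r" "m \<noteq> 0"
  shows "((\<lambda>z. bump \<delta> r (m *\<^sub>R z + c)) has_integral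
    bump_mass TYPE('a \<times> 'b) \<delta> r / \<bar>m\<bar> ^ DIM('a \<times> 'b)) UNIV"
proof -
  obtain u v :: "'a \<times> 'b" where
    uv: "\<And>z. norm (fst z) \<le> \<delta> \<Longrightarrow> norm (snd z) \<le> r \<Longrightarrow> z \<in> cbox u v"
    using cylinder_in_cbox[of \<delta> r] by blast
  have "((\<lambda>z. bump \<delta> r (m *\<^sub>R z + c)) has_integral
    (1 / \<bar>m\<bar> ^ DIM('a \<times> 'b)) *\<^sub>R bump_mass TYPE('a \<times> 'b) \<delta> r) UNIV"
    by (rule has_integral_affinity_UNIV[OF has_integral_bump[OF assms(1,2)] _ assms(3), of u v])
       (use bump_support(1,2)[of \<delta> r, OF disjI1 assms(1,2)] in \<open>auto intro!: uv less_imp_le\<close>)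
  then show ?thesis by simp
qed

lemma bump_mass_pos:
  assumes "0 < \<delta>" "0 < r"
  shows "0 < bump_mass TYPE('a::euclidean_space \<times> 'b::euclidean_space) \<delta> r"
proof -
  obtain u v :: "'a \<times> 'b" where
    uv: "\<And>z. norm (fst z) \<le> \<delta> \<Longrightarrow> norm (snd z) \<le> r \<Longrightarrow> z \<in> cbox u v"
    using cylinder_in_cbox[of \<delta> r] by blast
  have "(bump \<delta> r has_integral bump_mass TYPE('a \<times> 'b) \<delta> r) (cbox u v)"
    by (rule has_integral_on_support[OF has_integral_bump[OF assms]])
       (use bump_support(1,2)[of \<delta> r, OF disjI1 assms] in \<open>auto intro!: uv less_imp_le\<close>)
  moreover have "0 \<le> bump_mass TYPE('a \<times> 'b) \<delta> r"
    unfolding bump_mass_def by (rule integral_nonneg) (use has_integral_bump[OF assms] in auto)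
  moreover have "bump_mass TYPE('a \<times> 'b) \<delta> r \<noteq> 0"
  proof
    assume 0: "bump_mass TYPE('a \<times> 'b) \<delta> r = 0"
    have "bump \<delta> r (0 :: 'a \<times> 'b) = 0"
    proof (rule has_integral_0_cbox_imp_0[of u v "bump \<delta> r"])
      show "continuous_on (cbox u v) (bump \<delta> r)" by (rule continuous_on_bump) (rule continuous_on_id)
      show "(bump \<delta> r has_integral 0) (cbox u v)" using calculation(1) 0 by simp
      show "(0 :: 'a \<times> 'b) \<in> cbox u v" by (rule uv) (use assms in auto)
      show "box u v \<noteq> {}"
      proof -
        have "cball (0::'a) \<delta> \<times> cball (0::'b) r \<subseteq> cbox u v" using uv by auto
        then have "interior (cball (0::'a) \<delta> \<times> cball (0::'b) r) \<subseteq> interior (cbox u v)"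
          by (rule interior_mono)
        then have "ball (0::'a) \<delta> \<times> ball (0::'b) r \<subseteq> box u v"
          by (simp add: interior_Times interior_cbox)
        moreover have "(0, 0) \<in> ball (0::'a) \<delta> \<times> ball (0::'b) r" using assms by simp
        ultimately show ?thesis by blast
      qed
    qed auto
    then show False by (simp add: bump_def level_def)
  qed
  ultimately show ?thesis by linarith
qed

text \<open>
  This cancellation allows any constant to be subtracted from a flux before it is estimated.
\<close>

lemma has_integral_bump_grad_0:
  fixes c v :: "'a::euclidean_space \<times> 'b::euclidean_space"
  assumes "0 < \<delta>" "0 < r"
  shows "((\<lambda>a. bump_grad \<delta> r (a - c) \<bullet> v) has_integral 0) UNIV"
proof -
  let ?f = "\<lambda>a. bump_grad \<delta> r a \<bullet> v"
  obtain u w :: "'a \<times> 'b" where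
    uv: "\<And>z. norm (fst z) \<le> \<delta> \<Longrightarrow> norm (snd z) \<le> r \<Longrightarrow> z \<in> cbox u w"
    using cylinder_in_cbox[of \<delta> r] by blast
  have supp: "a \<in> cbox u w" if "?f a \<noteq> 0" for a
  proof -
    from that have "bump_grad \<delta> r a \<noteq> 0" by auto
    from bump_support[OF disjI2[OF this] assms] show ?thesis by (auto intro!: uv less_imp_le)
  qed
  have I: "(?f has_integral integral UNIV ?f) UNIV"
    by (rule has_integral_UNIV_compact_support[OF _ supp]) (intro continuous_intros)
  have odd: "?f ((-1) *\<^sub>R x + 0) = - ?f x" for x
    by (simp add: bump_grad_def level_def inner_prod_def)
  have "((\<lambda>a. - ?f a) has_integral integral UNIV ?f) UNIV"
    using has_integral_affinity_UNIV[OF I supp, of "-1" 0] unfolding odd by simp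
  then have "integral UNIV ?f = - integral UNIV ?f"
    using has_integral_neg[OF I] has_integral_unique by blast
  then have "integral UNIV ?f = 0" by simp
  with I have "(?f has_integral 0) UNIV" by simp
  from has_integral_affinity_UNIV[OF this supp, of 1 "-c"] show ?thesis by simp
qed

definition cylinder :: "real \<Rightarrow> real \<Rightarrow> 'a::euclidean_space \<times> 'b::euclidean_space \<Rightarrow> ('a \<times> 'b) set" where
  "cylinder \<delta> r c = cball (fst c) \<delta> \<times> cball (snd c) r"

lemma bump_support_cylinder:
  assumes "bump \<delta> r (a - c) \<noteq> 0 \<or> bump_grad \<delta> r (a - c) \<noteq> 0" "0 < \<delta>" "0 < r"
  shows "a \<in> cylinder \<delta> r c"
  using bump_support[OF assms] by (cases a) (auto simp: cylinder_def dist_norm norm_minus_commute)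

lemma bump_integral_on:
  fixes c :: "'a::euclidean_space \<times> 'b::euclidean_space"
  assumes "0 < \<delta>" "0 < r" "cylinder \<delta> r c \<subseteq> K"
  shows "((\<lambda>a. bump \<delta> r (a - c)) has_integral bump_mass TYPE('a \<times> 'b) \<delta> r) K"
proof (rule has_integral_on_support)
  show "((\<lambda>a. bump \<delta> r (a - c)) has_integral bump_mass TYPE('a \<times> 'b) \<delta> r) UNIV"
    using has_integral_bump_affine[OF assms(1,2), of 1 "-c"] by simp
qed (use bump_support_cylinder assms in blast)

lemma bump_grad_integral_on:
  fixes c :: "'a::euclidean_space \<times> 'b::euclidean_space"
  assumes "0 < \<delta>" "0 < r" "cylinder \<delta> r c \<subseteq> K"
  shows "((\<lambda>a. bump_grad \<delta> r (a - c) \<bullet> v) has_integral 0) K"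
proof (rule has_integral_on_support[OF has_integral_bump_grad_0[OF assms(1,2)]])
  fix a assume "bump_grad \<delta> r (a - c) \<bullet> v \<noteq> 0"
  then have "bump_grad \<delta> r (a - c) \<noteq> 0" by auto
  then show "a \<in> K" using bump_support_cylinder assms by blast
qed

text \<open>
  Relative to the mass, the vertical gradient of a bump costs a factor \<open>1 / r\<close>, with a constant that
  depends on the dimension only, so that \<open>\<delta>\<close> can be shrunk at no cost.
\<close>

lemma integral_norm_snd_bump_grad_le:
  fixes c p q :: "'a::euclidean_space \<times> 'b::euclidean_space"
  assumes "0 < \<delta>" "0 < r"
  shows "integral (cbox p q) (\<lambda>a. norm (snd (bump_grad \<delta> r (a - c))))
    \<le> (8 * 2 ^ DIM('a \<times> 'b)) / r * bump_mass TYPE('a \<times> 'b) \<delta> r"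
proof -
  have "((\<lambda>a. bump \<delta> r ((1/2) *\<^sub>R (a - c))) has_integral
      bump_mass TYPE('a \<times> 'b) \<delta> r / (1/2) ^ DIM('a \<times> 'b)) UNIV"
    using has_integral_bump_affine[OF assms, of "1/2" "-((1/2) *\<^sub>R c)"] by (simp add: scaleR_diff_right)
  from has_integral_mult_right[OF this, of "8/r"]
  have U: "((\<lambda>a. 8 / r * bump \<delta> r ((1/2) *\<^sub>R (a - c))) has_integral
      8 * 2 ^ DIM('a \<times> 'b) / r * bump_mass TYPE('a \<times> 'b) \<delta> r) UNIV"
    by (simp add: power_divide field_simps)
  have I: "(\<lambda>a. 8 / r * bump \<delta> r ((1/2) *\<^sub>R (a - c))) integrable_on cbox p q"
    by (intro integrable_continuous continuous_intros)
  have "integral (cbox p q) (\<lambda>a. norm (snd (bump_grad \<delta> r (a - c))))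
      \<le> integral (cbox p q) (\<lambda>a. 8 / r * bump \<delta> r ((1/2) *\<^sub>R (a - c)))"
    by (rule integral_le[OF _ I])
       (intro integrable_continuous continuous_intros norm_snd_bump_grad_le[OF assms])+
  also have "\<dots> \<le> integral UNIV (\<lambda>a. 8 / r * bump \<delta> r ((1/2) *\<^sub>R (a - c)))"
    by (rule integral_subset_le[OF _ I]) (use U assms in auto)
  also have "\<dots> = 8 * 2 ^ DIM('a \<times> 'b) / r * bump_mass TYPE('a \<times> 'b) \<delta> r"
    using U by (rule integral_unique)
  finally show ?thesis .
qed

text \<open>
  Moving the bump rather than the function puts the derivative on the bump, so that an average of a
  merely continuous \<open>\<phi>\<close> is differentiable along the motion, with a derivative of the form that a
  distributional equation controls.
\<close>

lemma bump_average_derivative: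
  fixes \<phi> :: "'a::euclidean_space \<times> 'b::euclidean_space \<Rightarrow> real"
  assumes "continuous_on (cbox p q) \<phi>"
  shows "((\<lambda>t. integral (cbox p q) (\<lambda>a. \<phi> a * bump \<delta> r (a - (c + t *\<^sub>R Z)))) has_real_derivative
    integral (cbox p q) (\<lambda>a. - (\<phi> a * (bump_grad \<delta> r (a - (c + t *\<^sub>R Z)) \<bullet> Z)))) (at t within UNIV)"
proof (rule leibniz_rule_field_derivative)
  fix t a
  have 1: "((\<lambda>t. a - (c + t *\<^sub>R Z)) has_derivative (\<lambda>h. - (h *\<^sub>R Z))) (at t)"
    by (auto intro!: derivative_eq_intros)
  have "((\<lambda>t. bump \<delta> r (a - (c + t *\<^sub>R Z))) has_derivative
      (\<lambda>h. bump_grad \<delta> r (a - (c + t *\<^sub>R Z)) \<bullet> (- (h *\<^sub>R Z)))) (at t)"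
    by (rule has_derivative_compose[OF 1 bump_has_derivative])
  from has_derivative_mult_right[OF this, of "\<phi> a"]
  show "((\<lambda>t. \<phi> a * bump \<delta> r (a - (c + t *\<^sub>R Z))) has_field_derivative
        - (\<phi> a * (bump_grad \<delta> r (a - (c + t *\<^sub>R Z)) \<bullet> Z))) (at t within UNIV)"
    unfolding has_field_derivative_def by (rule has_derivative_eq_rhs) (auto simp: algebra_simps)
next
  fix t show "(\<lambda>a. \<phi> a * bump \<delta> r (a - (c + t *\<^sub>R Z))) integrable_on cbox p q"
    by (intro integrable_continuous continuous_intros assms)
next
  have "continuous_on (UNIV \<times> cbox p q) (\<lambda>x::real \<times> 'a \<times> 'b. \<phi> (snd x))"
    by (rule continuous_on_compose2[OF assms]) (auto intro!: continuous_intros)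
  then show "continuous_on (UNIV \<times> cbox p q)
      (\<lambda>(t, a). - (\<phi> a * (bump_grad \<delta> r (a - (c + t *\<^sub>R Z)) \<bullet> Z)))"
    unfolding split_beta by (intro continuous_intros)
qed auto

text \<open>
  The estimate behind both error terms of the transport argument: only the size of the factor
  \<open>\<bar>f\<bar> * norm v\<close> on the small cylinder around \<open>c\<close> matters.
\<close>

lemma flux_bound:
  fixes f :: "'a::euclidean_space \<times> 'b::euclidean_space \<Rightarrow> real" and v :: "'a \<times> 'b \<Rightarrow> 'b"
  assumes "0 < \<delta>" "0 < r"
    and "continuous_on (cbox p q) f" "continuous_on (cbox p q) v"
    and E: "0 \<le> E"
    and bd: "\<And>a. a \<in> cylinder \<delta> r c \<Longrightarrow> a \<in> cbox p q \<Longrightarrow> \<bar>f a\<bar> * norm (v a) \<le> E"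
  shows "\<bar>integral (cbox p q) (\<lambda>a. f a * (snd (bump_grad \<delta> r (a - c)) \<bullet> v a))\<bar>
    \<le> E * ((8 * 2 ^ DIM('a \<times> 'b)) / r * bump_mass TYPE('a \<times> 'b) \<delta> r)"
proof -
  have "norm (integral (cbox p q) (\<lambda>a. f a * (snd (bump_grad \<delta> r (a - c)) \<bullet> v a)))
      \<le> integral (cbox p q) (\<lambda>a. E * norm (snd (bump_grad \<delta> r (a - c))))"
  proof (rule integral_norm_bound_integral)
    show "(\<lambda>a. f a * (snd (bump_grad \<delta> r (a - c)) \<bullet> v a)) integrable_on cbox p q"
      by (intro integrable_continuous continuous_intros assms)
    show "(\<lambda>a. E * norm (snd (bump_grad \<delta> r (a - c)))) integrable_on cbox p q"
      by (intro integrable_continuous continuous_intros)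
    fix a assume a: "a \<in> cbox p q"
    let ?g = "snd (bump_grad \<delta> r (a - c))"
    show "norm (f a * (?g \<bullet> v a)) \<le> E * norm ?g"
    proof (cases "bump_grad \<delta> r (a - c) = 0")
      case False
      then have "\<bar>f a\<bar> * norm (v a) \<le> E"
        using bump_support_cylinder assms(1,2) a bd by blast
      have "norm (f a * (?g \<bullet> v a)) \<le> \<bar>f a\<bar> * (norm ?g * norm (v a))"
        unfolding real_norm_def abs_mult
        by (intro mult_left_mono Cauchy_Schwarz_ineq2) auto
      also have "\<dots> = (\<bar>f a\<bar> * norm (v a)) * norm ?g" by simp
      also have "\<dots> \<le> E * norm ?g" by (intro mult_right_mono norm_ge_zero) fact
      finally show ?thesis .
    qed (use E in auto)
  qed
  also have "\<dots> = E * integral (cbox p q) (\<lambda>a. norm (snd (bump_grad \<delta> r (a - c))))" by simp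
  also have "\<dots> \<le> E * ((8 * 2 ^ DIM('a \<times> 'b)) / r * bump_mass TYPE('a \<times> 'b) \<delta> r)"
    by (intro mult_left_mono integral_norm_snd_bump_grad_le assms E)
  finally show ?thesis by simp
qed

section \<open>Transport along frozen characteristics\<close>

text \<open>
  Let \<open>g t\<close> be the increment of \<open>\<phi>\<close> between \<open>a0\<close> and \<open>a0 + t *\<^sub>R Z\<close>, where \<open>Z\<close> is the characteristic
  direction with the coefficient \<open>\<phi>\<close> frozen at \<open>a0\<close>. Up to the oscillation \<open>\<kappa>\<close> of \<open>\<phi>\<close> on the support
  of the bump, \<open>g t\<close> is an increment of bump averages. The derivative of such an average consists of
  three parts: the source, bounded through the weak equation; an error from freezing the field
  \<open>\<omega> (fst a) \<xi>\<close> at the centre of the bump, small with \<open>\<delta>\<close>; and the flux of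
  \<open>(\<phi> - \<phi> a0)\<^sup>2 / 2\<close> in direction \<open>\<beta> \<xi>\<close>. Subtracting the constant \<open>(g t)\<^sup>2 / 2\<close> bounds the flux density by
  \<open>\<kappa> (2 G + \<kappa>) / 2\<close>, with \<open>G\<close> the maximum of \<open>\<bar>g\<bar>\<close>, and the vertical gradient costs \<open>1 / r\<close>.

  Hoelder continuity makes \<open>\<kappa>\<close> proportional to \<open>sqrt r\<close>. With \<open>r = (s * norm \<xi>)\<^sup>2\<close> the oscillation is
  therefore of the order of \<open>norm \<xi>\<close>, as wanted, while the coefficient of \<open>G\<close> in the flux is
  proportional to \<open>1 / s\<close>. The value of \<open>s\<close> makes this coefficient \<open>1/2\<close>, so that \<open>G\<close> can be absorbed.
  The hypothesis \<open>weak\<close> is the only trace of the equation.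
\<close>

lemma characteristic_estimate:
  fixes \<phi> :: "'a::euclidean_space \<times> 'b::euclidean_space \<Rightarrow> real"
    and \<omega> :: "'a \<Rightarrow> 'a \<Rightarrow> 'b" and \<beta> :: "'a \<Rightarrow> 'b" and a0 :: "'a \<times> 'b" and \<xi> :: 'a
  defines "Z \<equiv> (\<xi>, (1/2) *\<^sub>R \<omega> (fst a0) \<xi> + \<phi> a0 *\<^sub>R \<beta> \<xi>)"
  assumes bil: "bounded_bilinear \<omega>" and alt: "\<omega> \<xi> \<xi> = 0"
    and b: "norm (\<beta> \<xi>) \<le> b * norm \<xi>" "0 < b"
    and C: "0 < C" and M: "0 \<le> M" and \<rho>: "0 < \<rho>"
    and s: "s = 4 * C * b * (8 * 2 ^ DIM('a \<times> 'b))"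
    and cont: "continuous_on (cbox p q) \<phi>"
    and hoelder: "\<And>x y y'. (x, y) \<in> cbox p q \<Longrightarrow> (x, y') \<in> cbox p q \<Longrightarrow>
        \<bar>\<phi> (x, y) - \<phi> (x, y')\<bar> \<le> C * sqrt (norm (y - y'))"
    and weak: "\<And>c \<delta> r. 0 < \<delta> \<Longrightarrow> 0 < r \<Longrightarrow> cylinder \<delta> r c \<subseteq> cbox p q \<Longrightarrow>
        \<bar>integral (cbox p q) (\<lambda>a. \<phi> a *
            (bump_grad \<delta> r (a - c) \<bullet> (\<xi>, (1/2) *\<^sub>R \<omega> (fst a) \<xi> + (\<phi> a / 2) *\<^sub>R \<beta> \<xi>)))\<bar>
        \<le> M * norm \<xi> * bump_mass TYPE('a \<times> 'b) \<delta> r"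
    and tube: "\<And>t. 0 \<le> t \<Longrightarrow> t \<le> 1 \<Longrightarrow> cylinder \<rho> ((s * norm \<xi>)\<^sup>2) (a0 + t *\<^sub>R Z) \<subseteq> cbox p q"
  shows "\<bar>\<phi> (a0 + Z) - \<phi> a0\<bar> \<le> (9 * C * s + 2 * M + 2) * norm \<xi>"
proof (cases "\<xi> = 0")
  case True
  then have "\<beta> \<xi> = 0" using b by simp
  moreover have "\<omega> (fst a0) \<xi> = 0" using True bil by (simp add: bounded_bilinear.zero_right)
  ultimately have "Z = 0" using True by (simp add: Z_def zero_prod_def)
  then show ?thesis using True by simp
next
  case False
  define N where "N = 8 * (2::real) ^ DIM('a \<times> 'b)"
  define h where "h = norm \<xi>"
  define r where "r = (s * h)\<^sup>2"
  define \<kappa> where "\<kappa> = 2 * C * s * h"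
  define c where "c t = a0 + t *\<^sub>R Z" for t :: real
  define \<phi>0 where "\<phi>0 = \<phi> a0"
  define g where "g t = \<phi> (c t) - \<phi>0" for t :: real
  let ?K = "cbox p q"
  have N: "0 < N" by (simp add: N_def)
  have h: "0 < h" using False by (simp add: h_def)
  have s': "s = 4 * C * b * N" by (simp add: s N_def)
  have s0: "0 < s" using s' C b N by simp
  have r: "0 < r" using s0 h by (simp add: r_def)
  have \<kappa>: "0 < \<kappa>" using C s0 h by (simp add: \<kappa>_def)
  have sqr: "sqrt r = s * h" using s0 h by (simp add: r_def)
  have tube': "cylinder \<rho> r (c t) \<subseteq> ?K" if "0 \<le> t" "t \<le> 1" for t
    using tube[OF that] by (simp add: c_def r_def h_def)
  have cK: "c t \<in> ?K" if "0 \<le> t" "t \<le> 1" for t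
    using tube'[OF that] \<rho> r by (auto simp: cylinder_def mem_Times_iff)

  have "continuous_on {0..1} (\<lambda>t. \<bar>g t\<bar>)"
    unfolding g_def
    by (intro continuous_intros continuous_on_compose2[OF cont]) (auto simp: c_def cK[unfolded c_def] intro!: continuous_intros)
  then obtain \<sigma> where \<sigma>: "0 \<le> \<sigma>" "\<sigma> \<le> 1" and g_max: "\<And>t. 0 \<le> t \<Longrightarrow> t \<le> 1 \<Longrightarrow> \<bar>g t\<bar> \<le> \<bar>g \<sigma>\<bar>"
    using continuous_attains_sup[of "{0..1::real}" "\<lambda>t. \<bar>g t\<bar>"] by auto
  define G where "G = \<bar>g \<sigma>\<bar>"

  have "compact (\<phi> ` ?K)" by (rule compact_continuous_image[OF cont compact_cbox])
  then obtain \<Phi> where \<Phi>: "0 < \<Phi>" "\<And>a. a \<in> ?K \<Longrightarrow> \<bar>\<phi> a\<bar> \<le> \<Phi>"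
    using compact_imp_bounded[THEN bounded_pos[THEN iffD1]] by (metis imageI real_norm_def)
  obtain W where W: "0 < W" "\<And>x y. norm (\<omega> x y) \<le> norm x * norm y * W"
    using bounded_bilinear.pos_bounded[OF bil] by blast
  have "uniformly_continuous_on ?K \<phi>" by (rule compact_uniformly_continuous[OF cont compact_cbox])
  moreover have "0 < C * s * h" using C s0 h by simp
  ultimately obtain \<delta>1 where \<delta>1: "0 < \<delta>1"
      "\<And>a a'. a \<in> ?K \<Longrightarrow> a' \<in> ?K \<Longrightarrow> dist a' a < \<delta>1 \<Longrightarrow> dist (\<phi> a') (\<phi> a) < C * s * h"
    unfolding uniformly_continuous_on_def by metis
  \<comment> \<open>The second entry keeps the horizontal oscillation of \<open>\<phi>\<close> below the Hoelder bound of its vertical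
    one, the third bounds the error of freezing \<open>\<omega>\<close> by \<open>norm \<xi>\<close> times the mass of the bump.\<close>
  define \<delta> where "\<delta> = min \<rho> (min (\<delta>1 / 2) (r / (\<Phi> * W * N)))"
  have \<delta>: "0 < \<delta>" "\<delta> \<le> \<rho>" "\<delta> < \<delta>1" "\<Phi> * W * \<delta> * N \<le> r"
  proof -
    show "0 < \<delta>" using \<rho> \<delta>1(1) r \<Phi>(1) W(1) N by (simp add: \<delta>_def)
    show "\<delta> \<le> \<rho>" by (simp add: \<delta>_def)
    have "\<delta> \<le> \<delta>1 / 2" unfolding \<delta>_def by linarith
    then show "\<delta> < \<delta>1" using \<delta>1(1) by simp
    have "\<delta> \<le> r / (\<Phi> * W * N)" by (simp add: \<delta>_def)
    then show "\<Phi> * W * \<delta> * N \<le> r" using \<Phi>(1) W(1) N by (simp add: field_simps)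
  qed
  define I where "I = bump_mass TYPE('a \<times> 'b) \<delta> r"
  have I: "0 < I" unfolding I_def by (rule bump_mass_pos) fact+
  have cyl: "cylinder \<delta> r (c t) \<subseteq> ?K" if "0 \<le> t" "t \<le> 1" for t
    using tube'[OF that] \<delta>(2) unfolding cylinder_def by fastforce

  have osc: "\<bar>\<phi> a - \<phi> (c t)\<bar> \<le> \<kappa>" if t: "0 \<le> t" "t \<le> 1" and a: "a \<in> cylinder \<delta> r (c t)" for a t
  proof -
    obtain x y where xy: "a = (x, y)" by fastforce
    obtain x' y' where xy': "c t = (x', y')" by fastforce
    have d: "dist x' x \<le> \<delta>" "dist y' y \<le> r" using a by (auto simp: cylinder_def xy xy')
    have K: "(x, y) \<in> ?K" "(x', y) \<in> ?K" "(x', y') \<in> ?K"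
      using cyl[OF t] a cK[OF t] d r \<delta>(1) by (auto simp: cylinder_def xy xy')
    have "dist (x, y) (x', y) < \<delta>1"
      using d(1) \<delta>(3) by (simp add: dist_Pair_Pair dist_commute)
    then have 1: "\<bar>\<phi> (x, y) - \<phi> (x', y)\<bar> \<le> C * s * h"
      using \<delta>1(2)[OF K(2,1)] by (simp add: dist_real_def)
    have "\<bar>\<phi> (x', y) - \<phi> (x', y')\<bar> \<le> C * sqrt (norm (y - y'))" by (rule hoelder) fact+
    also have "\<dots> \<le> C * sqrt r"
      using C d(2) by (intro mult_left_mono real_sqrt_le_mono) (auto simp: dist_norm norm_minus_commute)
    finally have 2: "\<bar>\<phi> (x', y) - \<phi> (x', y')\<bar> \<le> C * s * h" by (simp add: sqr)
    show ?thesis using 1 2 by (simp add: xy xy' \<kappa>_def)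
  qed

  define F where "F t = integral ?K (\<lambda>a. \<phi> a * bump \<delta> r (a - c t))" for t
  have F_close: "\<bar>F t - \<phi> (c t) * I\<bar> \<le> \<kappa> * I" if t: "0 \<le> t" "t \<le> 1" for t
  proof -
    have B: "((\<lambda>a. bump \<delta> r (a - c t)) has_integral I) ?K"
      unfolding I_def by (rule bump_integral_on[OF \<delta>(1) r cyl[OF t]])
    have "((\<lambda>a. \<phi> a * bump \<delta> r (a - c t)) has_integral F t) ?K"
      unfolding F_def by (intro integrable_integral integrable_continuous continuous_intros cont)
    from has_integral_diff[OF this has_integral_mult_right[OF B, of "\<phi> (c t)"]]
    have D: "((\<lambda>a. (\<phi> a - \<phi> (c t)) * bump \<delta> r (a - c t)) has_integral F t - \<phi> (c t) * I) ?K"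
      by (simp add: algebra_simps)
    have "norm (F t - \<phi> (c t) * I) \<le> \<kappa> * I"
      unfolding integral_unique[OF D, symmetric]
        integral_unique[OF has_integral_mult_right[OF B, of \<kappa>], symmetric]
    proof (rule integral_norm_bound_integral)
      fix a assume "a \<in> ?K"
      show "norm ((\<phi> a - \<phi> (c t)) * bump \<delta> r (a - c t)) \<le> \<kappa> * bump \<delta> r (a - c t)"
      proof (cases "bump \<delta> r (a - c t) = 0")
        case False
        then have "\<bar>\<phi> a - \<phi> (c t)\<bar> \<le> \<kappa>"
          by (intro osc[OF t] bump_support_cylinder[OF disjI1 \<delta>(1) r])
        then show ?thesis by (simp add: abs_mult mult_right_mono)
      qed simp
    qed (use D has_integral_mult_right[OF B, of \<kappa>] in blast)+
    then show ?thesis by simp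
  qed

  define D where "D = M * h + h + (G / 2 + \<kappa> / 4)"
  have F_der: "\<exists>d. (F has_real_derivative d) (at t) \<and> \<bar>d\<bar> \<le> D * I" if t: "0 \<le> t" "t \<le> 1" for t
  proof -
    let ?g = "\<lambda>a. bump_grad \<delta> r (a - c t)"
    \<comment> \<open>\<open>f1\<close> is the integrand of the weak equation, \<open>f2\<close> the error of freezing \<open>\<omega>\<close>, \<open>f3\<close> the flux
      after subtraction of its value at the centre, and \<open>f4\<close> the subtracted constants.\<close>
    let ?f1 = "\<lambda>a. \<phi> a * (?g a \<bullet> (\<xi>, (1/2) *\<^sub>R \<omega> (fst a) \<xi> + (\<phi> a / 2) *\<^sub>R \<beta> \<xi>))"
    let ?f2 = "\<lambda>a. (\<phi> a / 2) * (snd (?g a) \<bullet> \<omega> (fst a0 - fst a) \<xi>)"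
    let ?f3 = "\<lambda>a. (- ((\<phi> a - \<phi>0)\<^sup>2 - (g t)\<^sup>2) / 2) * (snd (?g a) \<bullet> \<beta> \<xi>)"
    let ?f4 = "\<lambda>a. ((\<phi>0\<^sup>2 - (g t)\<^sup>2) / 2) * (?g a \<bullet> (0, \<beta> \<xi>))"
    have split: "\<phi> a * (?g a \<bullet> Z) = ?f1 a + ?f2 a + ?f3 a + ?f4 a" for a
      by (simp add: Z_def inner_prod_def inner_add_right bounded_bilinear.diff_left[OF bil]
          inner_diff_right \<phi>0_def[symmetric] power2_eq_square field_simps)
    have contw [continuous_intros]: "continuous_on ?K (\<lambda>a. \<omega> (f a) \<xi>)" if "continuous_on ?K f" for f
      by (rule bounded_linear.continuous_on[OF bounded_bilinear.bounded_linear_left[OF bil] that])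
    have int: "?f1 integrable_on ?K" "?f2 integrable_on ?K" "?f3 integrable_on ?K" "?f4 integrable_on ?K"
      by (intro integrable_continuous continuous_intros cont; simp)+
    have 1: "\<bar>integral ?K ?f1\<bar> \<le> M * h * I"
      unfolding h_def I_def by (rule weak[OF \<delta>(1) r cyl[OF t]])
    have 2: "\<bar>integral ?K ?f2\<bar> \<le> h * I"
    proof -
      have "\<bar>integral ?K ?f2\<bar> \<le> (\<Phi> / 2 * (\<delta> * h * W)) * (N / r * I)"
        unfolding N_def I_def
      proof (rule flux_bound[OF \<delta>(1) r])
        fix a assume a: "a \<in> cylinder \<delta> r (c t)" "a \<in> ?K"
        \<comment> \<open>Since \<open>\<omega> \<xi> \<xi> = 0\<close>, the frozen field is the same at all centres \<open>c t\<close>.\<close>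
        have "\<omega> (fst a0 - fst a) \<xi> = \<omega> (fst (c t) - fst a) \<xi>"
          by (simp add: c_def Z_def bounded_bilinear.diff_left[OF bil] bounded_bilinear.add_left[OF bil]
              bounded_bilinear.scaleR_left[OF bil] alt)
        moreover have "norm (fst (c t) - fst a) \<le> \<delta>" using a by (auto simp: cylinder_def dist_norm)
        ultimately have "norm (\<omega> (fst a0 - fst a) \<xi>) \<le> \<delta> * h * W"
          using W(1) h by (auto intro!: order_trans[OF W(2)] mult_right_mono simp: h_def)
        then show "\<bar>\<phi> a / 2\<bar> * norm (\<omega> (fst a0 - fst a) \<xi>) \<le> \<Phi> / 2 * (\<delta> * h * W)"
          using \<Phi> a by (intro mult_mono) auto
      qed (use \<Phi>(1) W(1) h \<delta>(1) in \<open>auto intro!: continuous_intros cont\<close>)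
      also have "\<dots> = (\<Phi> * W * \<delta> * N) / r * (1/2) * h * I" by (simp add: field_simps)
      also have "\<dots> \<le> 1 * 1 * h * I"
        using \<delta> r h I \<Phi>(1) W(1) N by (intro mult_mono) auto
      finally show ?thesis by simp
    qed
    have 3: "\<bar>integral ?K ?f3\<bar> \<le> (G / 2 + \<kappa> / 4) * I"
    proof -
      have "\<bar>integral ?K ?f3\<bar> \<le> ((\<kappa> * (2 * G + \<kappa>)) / 2 * (b * h)) * (N / r * I)"
        unfolding N_def I_def
      proof (rule flux_bound[OF \<delta>(1) r])
        fix a assume a: "a \<in> cylinder \<delta> r (c t)" "a \<in> ?K"
        have o: "\<bar>\<phi> a - \<phi> (c t)\<bar> \<le> \<kappa>" using osc[OF t a(1)] .
        have gt: "\<bar>g t\<bar> \<le> G" using g_max[OF t] by (simp add: G_def)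
        have "(\<phi> a - \<phi>0)\<^sup>2 - (g t)\<^sup>2 = (\<phi> a - \<phi> (c t)) * (\<phi> a - \<phi> (c t) + 2 * g t)"
          by (simp add: g_def power2_eq_square algebra_simps)
        then have "\<bar>(\<phi> a - \<phi>0)\<^sup>2 - (g t)\<^sup>2\<bar> \<le> \<kappa> * (2 * G + \<kappa>)"
          using o gt \<kappa> by (auto simp: abs_mult intro!: mult_mono)
        then have "\<bar>- ((\<phi> a - \<phi>0)\<^sup>2 - (g t)\<^sup>2) / 2\<bar> \<le> (\<kappa> * (2 * G + \<kappa>)) / 2" by simp
        then show "\<bar>- ((\<phi> a - \<phi>0)\<^sup>2 - (g t)\<^sup>2) / 2\<bar> * norm (\<beta> \<xi>) \<le> (\<kappa> * (2 * G + \<kappa>)) / 2 * (b * h)"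
          using b(1) \<kappa> by (intro mult_mono) (auto simp: h_def G_def)
      qed (use b \<kappa> h in \<open>auto intro!: continuous_intros cont simp: G_def\<close>)
      also have "\<dots> = (\<kappa> * b * h * N / r) * ((2 * G + \<kappa>) / 2) * I" by (simp add: field_simps)
      also have "\<kappa> * b * h * N / r = 1/2"
        using C b N h by (simp add: \<kappa>_def r_def s' power2_eq_square field_simps)
      finally show ?thesis by (simp add: field_simps)
    qed
    have 4: "integral ?K ?f4 = 0"
      using has_integral_mult_right[OF bump_grad_integral_on[OF \<delta>(1) r cyl[OF t]]]
      by (metis integral_unique mult_zero_right)
    have "integral ?K (\<lambda>a. \<phi> a * (?g a \<bullet> Z))
        = integral ?K ?f1 + integral ?K ?f2 + integral ?K ?f3 + integral ?K ?f4"
      unfolding split using int by (simp add: integral_add integrable_add)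
    then have "\<bar>integral ?K (\<lambda>a. - (\<phi> a * (?g a \<bullet> Z)))\<bar> \<le> D * I"
      using 1 2 3 4 by (simp add: D_def algebra_simps)
    moreover have "(F has_real_derivative integral ?K (\<lambda>a. - (\<phi> a * (?g a \<bullet> Z)))) (at t)"
      using bump_average_derivative[OF cont] by (simp add: F_def[abs_def] c_def)
    ultimately show ?thesis by blast
  qed
  then obtain F' where F': "\<And>t. 0 \<le> t \<Longrightarrow> t \<le> 1 \<Longrightarrow> (F has_real_derivative F' t) (at t)"
      "\<And>t. 0 \<le> t \<Longrightarrow> t \<le> 1 \<Longrightarrow> \<bar>F' t\<bar> \<le> D * I"
    by metis
  have D: "0 \<le> D" using M h \<kappa> by (simp add: D_def G_def)
  have "norm (F \<sigma> - F 0) \<le> (D * I) * norm (\<sigma> - 0)"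
    by (rule field_differentiable_bound[of "{0..1}" F F'])
       (use F' \<sigma> in \<open>auto intro: has_field_derivative_at_within\<close>)
  also have "\<dots> \<le> (D * I) * 1" using \<sigma> D I by (intro mult_left_mono) auto
  finally have "\<bar>F \<sigma> - F 0\<bar> \<le> D * I" by simp
  moreover have "c 0 = a0" by (simp add: c_def)
  ultimately have "\<bar>\<phi> (c \<sigma>) * I - \<phi>0 * I\<bar> \<le> (2 * \<kappa> + D) * I"
    using F_close[of 0] F_close[OF \<sigma>] by (simp add: \<phi>0_def algebra_simps)
  then have "G * I \<le> (2 * \<kappa> + D) * I"
    using I by (simp add: G_def g_def abs_mult flip: left_diff_distrib)
  then have "G \<le> 2 * \<kappa> + D" using I by simp
  \<comment> \<open>Here \<open>G / 2\<close>, which is part of \<open>D\<close>, moves to the left-hand side.\<close>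
  then have "G \<le> (9 * C * s + 2 * M + 2) * h" by (simp add: D_def \<kappa>_def algebra_simps)
  moreover have "\<bar>\<phi> (a0 + Z) - \<phi> a0\<bar> \<le> G"
    using g_max[of 1] by (simp add: G_def g_def c_def \<phi>0_def)
  ultimately show ?thesis by (simp add: h_def)
qed

section \<open>Group coordinates\<close>

text \<open>
  In the basis given by \<open>None\<close> and the \<open>Some j\<close>, each structure matrix splits into its block on the
  coordinates \<open>Some j\<close> and its column \<open>None\<close>. The block gives the alternating form \<open>hform\<close>, the column
  the linear map \<open>coupling\<close>; by skew-symmetry they determine the matrix.
\<close>

definition hform :: "('k::finite, 'n::finite) structure_mats \<Rightarrow> real^'k \<Rightarrow> real^'k \<Rightarrow> real^'n" where
  "hform B x \<xi> = (\<chi> s. \<Sum>j\<in>UNIV. \<Sum>l\<in>UNIV. B s $ Some j $ Some l * x $ l * \<xi> $ j)"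

definition coupling :: "('k::finite, 'n::finite) structure_mats \<Rightarrow> real^'k \<Rightarrow> real^'n" where
  "coupling B \<xi> = (\<chi> s. \<Sum>j\<in>UNIV. B s $ Some j $ None * \<xi> $ j)"

definition hvec :: "real \<Rightarrow> real^'k::finite \<Rightarrow> real^'k option" where
  "hvec t x = (\<chi> j. case j of None \<Rightarrow> t | Some l \<Rightarrow> x $ l)"

lemma sum_UNIV_option: "(\<Sum>i\<in>(UNIV :: 'a::finite option set). f i) = f None + (\<Sum>i\<in>UNIV. f (Some i))"
  by (simp add: UNIV_option_conv sum.reindex)

lemma hvec_add: "hvec t x + hvec t' x' = hvec (t + t') (x + x')"
  by (simp add: hvec_def vec_eq_iff split: option.split)

lemma hvec_0: "hvec 0 0 = 0"
  by (simp add: hvec_def vec_eq_iff split: option.split)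

lemma norm_hvec: "norm (hvec t x) = sqrt (t\<^sup>2 + (norm x)\<^sup>2)"
  by (simp add: norm_vec_def L2_set_def hvec_def sum_UNIV_option sum_nonneg)

lemma emb_W_hvec: "emb_W a = (hvec 0 (fst a), snd a)"
  by (simp add: emb_W_def hvec_def)

lemma emb_V_hvec: "emb_V t = (hvec t 0, 0)"
  by (auto simp: emb_V_def hvec_def vec_eq_iff axis_def split: option.split)

lemma structure_skew:
  assumes "step2_structure B"
  shows "B s $ i $ j = - (B s $ j $ i)"
proof -
  have "transpose (B s) $ j $ i = (- B s) $ j $ i"
    using assms by (simp add: step2_structure_def)
  then show ?thesis by (simp add: transpose_def)
qed

lemma form_hvec:
  assumes "step2_structure B"
  shows "(\<chi> s. (B s *v hvec t x) \<bullet> hvec t' x') = hform B x x' + t *\<^sub>R coupling B x' - t' *\<^sub>R coupling B x"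
proof (rule vec_eq_iff[THEN iffD2], rule allI)
  fix s
  have 0: "B s $ None $ None = 0" using structure_skew[OF assms, of s None None] by simp
  have "B s $ None $ Some l = - (B s $ Some l $ None)" for l
    by (rule structure_skew[OF assms])
  then show "(\<chi> s. (B s *v hvec t x) \<bullet> hvec t' x') $ s
      = (hform B x x' + t *\<^sub>R coupling B x' - t' *\<^sub>R coupling B x) $ s"
    by (simp add: hform_def coupling_def hvec_def inner_vec_def matrix_vector_mult_def sum_UNIV_option 0
        ring_distribs sum.distrib sum_distrib_left sum_distrib_right sum_negf mult_ac)
qed

lemma gmult_hvec:
  assumes "step2_structure B"
  shows "gmult B (hvec t x, y) (hvec t' x', y') =
    (hvec (t + t') (x + x'), y + y' + (1/2) *\<^sub>R (hform B x x' + t *\<^sub>R coupling B x' - t' *\<^sub>R coupling B x))"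
  by (simp add: gmult_def form_hvec[OF assms] hvec_add)

lemma bilinear_hform: "bilinear (hform B)"
  unfolding bilinear_def
  by (intro allI conjI; rule linearI)
     (simp_all add: hform_def vec_eq_iff ring_distribs sum.distrib sum_distrib_left mult_ac)

lemma bounded_bilinear_hform: "bounded_bilinear (hform B)"
  using bilinear_hform bilinear_conv_bounded_bilinear by blast

lemma linear_coupling: "linear (coupling B)"
  by (rule linearI) (simp_all add: coupling_def vec_eq_iff ring_distribs sum.distrib sum_distrib_left mult_ac)

lemma hform_alternating:
  assumes "step2_structure B"
  shows "hform B x x = 0"
proof -
  have "hform B x x $ s = - (hform B x x $ s)" for s
  proof -
    have "hform B x x $ s = (\<Sum>l\<in>UNIV. \<Sum>j\<in>UNIV. B s $ Some j $ Some l * x $ l * x $ j)"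
      unfolding hform_def by (simp, rule sum.swap)
    also have "\<dots> = (\<Sum>l\<in>UNIV. \<Sum>j\<in>UNIV. - (B s $ Some l $ Some j * x $ j * x $ l))"
    proof (intro sum.cong refl)
      fix l j
      have "B s $ Some j $ Some l = - (B s $ Some l $ Some j)" by (rule structure_skew[OF assms])
      then show "B s $ Some j $ Some l * x $ l * x $ j = - (B s $ Some l $ Some j * x $ j * x $ l)" by simp
    qed
    also have "\<dots> = - (hform B x x $ s)" by (simp add: hform_def sum_negf)
    finally show ?thesis .
  qed
  then show ?thesis by (simp add: vec_eq_iff)
qed

text \<open>
  The \<open>WW\<close>-component of the group increment between the graph points over \<open>a\<close> and \<open>a'\<close>, in parameter
  coordinates, when \<open>t\<close> is the value of the function at \<open>a\<close>. Its vertical part is the deviation of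
  \<open>a'\<close> from the endpoint of the characteristic segment that starts at \<open>a\<close> with the value \<open>t\<close> frozen.
\<close>

definition intrinsic_disp ::
    "('k::finite, 'n::finite) structure_mats \<Rightarrow> ('k, 'n) param \<Rightarrow> real \<Rightarrow> ('k, 'n) param \<Rightarrow> ('k, 'n) param" where
  "intrinsic_disp B a t a' = (fst a' - fst a,
     snd a' - snd a - (1/2) *\<^sub>R hform B (fst a) (fst a' - fst a) - t *\<^sub>R coupling B (fst a' - fst a))"

lemma gmult_intrinsic_disp:
  assumes "step2_structure B"
  shows "gmult B (gmult B (emb_W a) (emb_V t)) (gmult B (emb_W (intrinsic_disp B a t a')) (emb_V (t' - t)))
    = gmult B (emb_W a') (emb_V t')"
proof -
  define x \<xi> y y' where "x = fst a" and "\<xi> = fst a' - fst a" and "y = snd a" and "y' = snd a'"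
  have a: "a = (x, y)" "a' = (x + \<xi>, y')" by (simp_all add: x_def \<xi>_def y_def y'_def)
  have [simp]: "coupling B 0 = 0" "hform B v 0 = 0" "hform B 0 v = 0" for v
    by (simp_all add: linear_0[OF linear_coupling]
        bounded_bilinear.zero_left[OF bounded_bilinear_hform] bounded_bilinear.zero_right[OF bounded_bilinear_hform])
  show ?thesis
    unfolding a intrinsic_disp_def emb_W_hvec emb_V_hvec gmult_hvec[OF assms]
    by (simp add: linear_add[OF linear_coupling],
        simp add: vec_eq_iff, simp add: ring_distribs diff_divide_distrib add_divide_distrib)
qed

lemma gmult_left_cancel:
  assumes "gmult B p z = gmult B p z'"
  shows "z = z'"
proof -
  have "fst z = fst z'" using assms by (simp add: gmult_def)
  then show ?thesis using assms by (simp add: gmult_def prod_eq_iff)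
qed

lemma gmult_0_right: "gmult B p 0 = p"
  by (simp add: gmult_def prod_eq_iff vec_eq_iff)

lemma emb_0: "emb_W 0 = 0" "emb_V 0 = 0"
  by (simp_all add: emb_W_hvec emb_V_hvec hvec_0 zero_prod_def)

lemma hnorm_emb_W: "hnorm \<epsilon> (emb_W u) = max (norm (fst u)) (\<epsilon> * sqrt (norm (snd u)))"
  by (simp add: hnorm_def emb_W_hvec norm_hvec)

lemma hnorm_emb_V: "hnorm \<epsilon> (emb_V t) = \<bar>t\<bar>"
  by (simp add: hnorm_def emb_V_hvec norm_hvec)

text \<open>
  A graph point in the cone of opening \<open>1 / C\<close> with vertex \<open>p\<close> has an increment whose \<open>VV\<close>-part is at
  least \<open>C\<close> times its \<open>WW\<close>-part, whereas the hypothesis \<open>est\<close> bounds it by \<open>L < C\<close> times the same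
  quantity. So the \<open>WW\<close>-part vanishes, and with it the \<open>VV\<close>-part.
\<close>

lemma intrinsic_lipschitz_criterion:
  assumes B: "step2_structure B" and \<epsilon>: "0 < \<epsilon>" and L: "0 \<le> L"
    and \<phi>hat: "\<And>a. a \<in> A \<Longrightarrow> \<phi>hat (emb_W a) = emb_V (\<phi> a)"
    and est: "\<And>a a'. a \<in> A \<Longrightarrow> a' \<in> A \<Longrightarrow> \<bar>\<phi> a' - \<phi> a\<bar> \<le> L * hnorm \<epsilon> (emb_W (intrinsic_disp B a (\<phi> a) a'))"
  shows "intrinsic_lipschitz_with B \<epsilon> L (emb_W ` A) \<phi>hat"
  unfolding intrinsic_lipschitz_with_def
proof (intro conjI allI impI ballI L)
  fix C p assume C: "L < C" and p: "p \<in> igraph B (emb_W ` A) \<phi>hat"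
  from p obtain a where a: "a \<in> A" and "p = gmult B (emb_W a) (\<phi>hat (emb_W a))"
    unfolding igraph_def by blast
  then have p_eq: "p = gmult B (emb_W a) (emb_V (\<phi> a))" using \<phi>hat by simp
  show "icone B \<epsilon> p (1 / C) \<inter> igraph B (emb_W ` A) \<phi>hat = {p}"
  proof (intro equalityI subsetI)
    fix q assume "q \<in> icone B \<epsilon> p (1 / C) \<inter> igraph B (emb_W ` A) \<phi>hat"
    then have q: "q \<in> icone B \<epsilon> p (1 / C)" "q \<in> igraph B (emb_W ` A) \<phi>hat" by auto
    from q(1) obtain z where z: "q = gmult B p z" "hnorm \<epsilon> (proj_W B z) \<le> 1 / C * hnorm \<epsilon> (proj_V B z)"
      unfolding icone_def by blast
    from q(2) obtain a' where a': "a' \<in> A" "q = gmult B (emb_W a') (\<phi>hat (emb_W a'))"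
      unfolding igraph_def by blast
    define u where "u = intrinsic_disp B a (\<phi> a) a'"
    have "gmult B p z = gmult B p (gmult B (emb_W u) (emb_V (\<phi> a' - \<phi> a)))"
      using z(1)
      unfolding a'(2) \<phi>hat[OF a'(1)] gmult_intrinsic_disp[OF B, of a "\<phi> a" a' "\<phi> a'", symmetric]
        p_eq[symmetric] u_def[symmetric] by (rule sym)
    then have z_eq: "z = gmult B (emb_W u) (emb_V (\<phi> a' - \<phi> a))" by (rule gmult_left_cancel)
    have "hnorm \<epsilon> (emb_W u) \<le> 1 / C * \<bar>\<phi> a' - \<phi> a\<bar>"
      using z(2) unfolding z_eq
      by (simp add: proj_W_V WW_def VV_def hnorm_emb_V)
    then have 1: "C * hnorm \<epsilon> (emb_W u) \<le> \<bar>\<phi> a' - \<phi> a\<bar>"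
      using C L by (simp add: field_simps)
    have 2: "\<bar>\<phi> a' - \<phi> a\<bar> \<le> L * hnorm \<epsilon> (emb_W u)"
      using est[OF a a'(1)] by (simp add: u_def)
    have pos: "0 \<le> hnorm \<epsilon> (emb_W u)" by (simp add: hnorm_def le_max_iff_disj)
    have "hnorm \<epsilon> (emb_W u) = 0"
    proof (rule ccontr)
      assume "hnorm \<epsilon> (emb_W u) \<noteq> 0"
      then have "L * hnorm \<epsilon> (emb_W u) < C * hnorm \<epsilon> (emb_W u)" using C pos by simp
      then show False using 1 2 by linarith
    qed
    moreover from this have "u = 0"
      using \<epsilon> by (auto simp: hnorm_emb_W max_def prod_eq_iff mult_le_0_iff split: if_splits)
    ultimately have "z = 0" using 2 by (simp add: z_eq emb_0 gmult_0_right)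
    then show "q \<in> {p}" using z(1) by (simp add: gmult_0_right)
  next
    fix q assume "q \<in> {p}"
    then have q: "q = p" by simp
    have WW0: "0 \<in> WW" and VV0: "0 \<in> VV" unfolding WW_def VV_def by (metis emb_0 rangeI)+
    have "proj_W B 0 = 0" "proj_V B 0 = 0"
      using proj_W_V[OF WW0 VV0, of B] by (simp_all add: gmult_0_right)
    then have "p \<in> icone B \<epsilon> p (1 / C)"
      unfolding icone_def by (intro image_eqI[where x=0]) (simp_all add: gmult_0_right hnorm_def)
    then show "q \<in> icone B \<epsilon> p (1 / C) \<inter> igraph B (emb_W ` A) \<phi>hat" using p q by simp
  qed
qed

section \<open>The distributional equation tested with bumps\<close>

lemma set_lebesgue_integral_cbox:
  fixes f :: "'a::euclidean_space \<Rightarrow> real"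
  assumes "continuous_on (cbox p q) f" "\<And>a. a \<notin> cbox p q \<Longrightarrow> f a = 0" "cbox p q \<subseteq> S"
  shows "set_lebesgue_integral lebesgue S f = integral (cbox p q) f"
proof -
  have "(\<lambda>a. indicator S a *\<^sub>R f a) = (\<lambda>a. indicator (cbox p q) a *\<^sub>R f a)"
    using assms(2,3) by (auto simp: fun_eq_iff indicator_def)
  then have "set_lebesgue_integral lebesgue S f = set_lebesgue_integral lebesgue (cbox p q) f"
    by (simp add: set_lebesgue_integral_def)
  also have "\<dots> = integral (cbox p q) f"
    by (rule set_lebesgue_integral_eq_integral(2)) (rule absolutely_integrable_continuous[OF assms(1)])
  finally show ?thesis .
qed

lemma bump_translate_has_derivative:
  "((\<lambda>a. bump \<delta> r (a - c)) has_derivative (\<lambda>h. bump_grad \<delta> r (a - c) \<bullet> h)) (at a)"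
proof -
  have "((\<lambda>a. a - c) has_derivative (\<lambda>h. h)) (at a)" by (auto intro!: derivative_eq_intros)
  from has_derivative_compose[OF this bump_has_derivative] show ?thesis .
qed

lemma bump_C1c:
  fixes c :: "'a::euclidean_space \<times> 'b::euclidean_space"
  assumes "0 < \<delta>" "0 < r" "cylinder \<delta> r c \<subseteq> S"
  shows "(\<lambda>a. bump \<delta> r (a - c)) \<in> C1c S"
proof -
  have cl: "closure {a. bump \<delta> r (a - c) \<noteq> 0} \<subseteq> cylinder \<delta> r c"
  proof (rule closure_minimal)
    show "{a. bump \<delta> r (a - c) \<noteq> 0} \<subseteq> cylinder \<delta> r c"
      using bump_support_cylinder[OF disjI1 assms(1,2)] by blast
    show "closed (cylinder \<delta> r c)" by (simp add: cylinder_def closed_Times)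
  qed
  have "bounded (cylinder \<delta> r c)" by (simp add: cylinder_def bounded_Times)
  then have "compact (closure {a. bump \<delta> r (a - c) \<noteq> 0})"
    using cl by (meson bounded_subset closed_closure compact_eq_bounded_closed)
  moreover have "continuous_on UNIV (\<lambda>a. blinfun_inner_right (bump_grad \<delta> r (a - c)))"
    by (intro continuous_intros bounded_linear.continuous_on[OF bounded_linear_blinfun_inner_right])
  ultimately show ?thesis
    using cl assms(3) bump_translate_has_derivative[of \<delta> r c]
    by (auto simp: C1c_def intro!: exI[of _ "\<lambda>a. blinfun_inner_right (bump_grad \<delta> r (a - c))"])
qed

lemma weak_operator_bump:
  fixes B :: "('k::finite, 'n::finite) structure_mats"
  defines "\<zeta> c \<delta> r \<equiv> (\<lambda>a :: ('k, 'n) param. bump \<delta> r (a - c))"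
  shows "Xop B j (\<zeta> c \<delta> r) a + 1/2 * t * (\<Sum>s\<in>UNIV. B s $ Some j $ None * Yop s (\<zeta> c \<delta> r) a)
    = bump_grad \<delta> r (a - c) \<bullet>
      (axis j 1, (1/2) *\<^sub>R hform B (fst a) (axis j 1) + (t / 2) *\<^sub>R coupling B (axis j 1))"
proof -
  let ?g = "bump_grad \<delta> r (a - c)"
  have F: "frechet_derivative (\<zeta> c \<delta> r) (at a) = (\<lambda>h. ?g \<bullet> h)"
    unfolding \<zeta>_def by (rule frechet_derivative_at[OF bump_translate_has_derivative, symmetric])
  have Y: "Yop s (\<zeta> c \<delta> r) a = snd ?g $ s" for s
    by (simp add: Yop_def F inner_prod_def inner_axis)
  have o: "hform B x (axis j 1) $ s = (\<Sum>l\<in>UNIV. B s $ Some j $ Some l * x $ l)" for x s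
    by (simp add: hform_def axis_def if_distrib[of "\<lambda>z. _ * z"] sum.delta' cong: if_cong)
       (subst sum.swap, simp add: sum.delta')
  have v: "coupling B (axis j 1) $ s = B s $ Some j $ None" for s
    by (simp add: coupling_def axis_def if_distrib[of "\<lambda>z. _ * z"] cong: if_cong)
  show ?thesis
    unfolding Xop_def F Y
    by (simp add: inner_prod_def inner_add_right o v inner_vec_def[of "snd _"] sum_distrib_left
        sum_distrib_right sum.distrib mult_ac)
qed

text \<open>
  The equation in the coordinate directions gives, by linearity, the equation in direction \<open>\<xi>\<close>, which
  is the form of the hypothesis \<open>weak\<close> of \<open>characteristic_estimate\<close>. The factor \<open>CARD('k)\<close> comes from
  bounding every coordinate of \<open>\<xi>\<close> by its norm.
\<close>

lemma distributional_bump_bound: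
  fixes B :: "('k::finite, 'n::finite) structure_mats" and \<xi> :: "real^'k" and M :: real
  assumes sol: "distributional_solution B S \<phi> w" and K: "cbox p q \<subseteq> S"
    and w: "AE a in lebesgue. a \<in> cbox p q \<longrightarrow> norm (w a) \<le> M" and M: "0 \<le> M"
    and \<delta>: "0 < \<delta>" and r: "0 < r" and cyl: "cylinder \<delta> r c \<subseteq> cbox p q"
  shows "\<bar>integral (cbox p q) (\<lambda>a. \<phi> a *
            (bump_grad \<delta> r (a - c) \<bullet> (\<xi>, (1/2) *\<^sub>R hform B (fst a) \<xi> + (\<phi> a / 2) *\<^sub>R coupling B \<xi>)))\<bar>
        \<le> (CARD('k) * M) * norm \<xi> * bump_mass TYPE(('k, 'n) param) \<delta> r"
proof -
  let ?K = "cbox p q"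
  let ?I = "bump_mass TYPE(('k, 'n) param) \<delta> r"
  let ?\<zeta> = "\<lambda>a. bump \<delta> r (a - c)"
  define f where "f v a = \<phi> a *
    (bump_grad \<delta> r (a - c) \<bullet> (v, (1/2) *\<^sub>R hform B (fst a) v + (\<phi> a / 2) *\<^sub>R coupling B v))"
    for v :: "real^'k" and a
  have cont: "continuous_on ?K \<phi>"
    using sol K continuous_on_subset unfolding distributional_solution_def by blast
  have contw [continuous_intros]: "continuous_on ?K (\<lambda>a. hform B (g a) v)"
    if "continuous_on ?K g" for g and v :: "real^'k"
    by (rule bounded_linear.continuous_on[OF bounded_bilinear.bounded_linear_left[OF bounded_bilinear_hform] that])
  have contf: "continuous_on ?K (f v)" for v
    unfolding f_def by (intro continuous_intros cont) simp
  have f0: "f v a = 0" if "a \<notin> ?K" for v a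
  proof -
    have "bump_grad \<delta> r (a - c) = 0"
      using bump_support_cylinder[OF disjI2 \<delta> r] cyl that by blast
    then show ?thesis by (simp add: f_def)
  qed
  have Ij: "\<bar>integral ?K (f (axis j 1))\<bar> \<le> M * ?I" for j
  proof -
    have "?\<zeta> \<in> C1c S" using bump_C1c[OF \<delta> r] cyl K by blast
    then have "(LINT a:S|lebesgue. \<phi> a * (Xop B j ?\<zeta> a +
            1/2 * \<phi> a * (\<Sum>s\<in>UNIV. B s $ Some j $ None * Yop s ?\<zeta> a)))
        = - (LINT a:S|lebesgue. w a $ j * ?\<zeta> a)"
      using sol unfolding distributional_solution_def by blast
    then have "set_lebesgue_integral lebesgue S (f (axis j 1)) = - (LINT a:S|lebesgue. w a $ j * ?\<zeta> a)"
      unfolding weak_operator_bump f_def .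
    then have eq: "integral ?K (f (axis j 1)) = - (LINT a:S|lebesgue. w a $ j * ?\<zeta> a)"
      using set_lebesgue_integral_cbox[OF contf f0 K] by simp
    have "(?\<zeta> has_integral ?I) UNIV" by (rule bump_integral_on[OF \<delta> r]) simp
    then have "(\<lambda>a. M * ?\<zeta> a) absolutely_integrable_on UNIV" "integral UNIV (\<lambda>a. M * ?\<zeta> a) = M * ?I"
      using has_integral_mult_right[of ?\<zeta> ?I UNIV M] M
      by (auto intro!: nonnegative_absolutely_integrable_1 intro: integral_unique has_integral_integrable)
    then have dom: "integrable lebesgue (\<lambda>a. M * ?\<zeta> a)" "(LINT a|lebesgue. M * ?\<zeta> a) = M * ?I"
      using set_lebesgue_integral_eq_integral(2)[of UNIV "\<lambda>a. M * ?\<zeta> a"]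
      by (auto simp: set_integrable_def set_lebesgue_integral_def)
    have bd: "AE a in lebesgue. \<bar>indicator S a *\<^sub>R (w a $ j * ?\<zeta> a)\<bar> \<le> M * ?\<zeta> a"
      using w
    proof (rule AE_mp, intro AE_I2 impI)
      fix a assume a: "a \<in> ?K \<longrightarrow> norm (w a) \<le> M"
      show "\<bar>indicator S a *\<^sub>R (w a $ j * ?\<zeta> a)\<bar> \<le> M * ?\<zeta> a"
      proof (cases "a \<in> ?K")
        case True
        then have "\<bar>w a $ j\<bar> \<le> M" using a component_le_norm_cart[of "w a" j] by simp
        then have "\<bar>w a $ j * ?\<zeta> a\<bar> \<le> M * ?\<zeta> a" by (simp add: abs_mult mult_right_mono)
        then show ?thesis using M by (simp add: indicator_def)
      next
        case False
        then have "?\<zeta> a = 0" using bump_support_cylinder[OF disjI1 \<delta> r] cyl by blast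
        then show ?thesis by simp
      qed
    qed
    have "(LINT a:S|lebesgue. w a $ j * ?\<zeta> a) \<le> M * ?I"
      unfolding set_lebesgue_integral_def dom(2)[symmetric]
      by (rule integral_mono_AE'[OF dom(1)]) (use bd M in \<open>auto intro: AE_mp\<close>)
    moreover have "(LINT a|lebesgue. - (indicator S a *\<^sub>R (w a $ j * ?\<zeta> a))) \<le> M * ?I"
      unfolding dom(2)[symmetric]
      by (rule integral_mono_AE'[OF dom(1)]) (use bd M in \<open>auto intro: AE_mp\<close>)
    then have "- (LINT a:S|lebesgue. w a $ j * ?\<zeta> a) \<le> M * ?I"
      by (simp add: set_lebesgue_integral_def)
    ultimately show ?thesis unfolding eq by linarith
  qed
  have lin: "f \<xi> a = (\<Sum>j\<in>UNIV. \<xi> $ j * f (axis j 1) a)" for a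
  proof -
    let ?l = "\<lambda>v :: real^'k. (v, (1/2) *\<^sub>R hform B (fst a) v + (\<phi> a / 2) *\<^sub>R coupling B v)"
    have "linear ?l"
      by (rule linearI)
         (simp_all add: bounded_bilinear.add_right[OF bounded_bilinear_hform]
           bounded_bilinear.scaleR_right[OF bounded_bilinear_hform]
           linear_add[OF linear_coupling] linear_scale[OF linear_coupling] algebra_simps)
    then have "linear (\<lambda>v. \<phi> a * (bump_grad \<delta> r (a - c) \<bullet> ?l v))"
      using linear_compose[of ?l "\<lambda>z. \<phi> a * (bump_grad \<delta> r (a - c) \<bullet> z)"]
      by (simp add: o_def linear_iff inner_add_right distrib_left)
    then have L: "linear (\<lambda>v. f v a)" unfolding f_def .
    have "f \<xi> a = f (\<Sum>j\<in>UNIV. \<xi> $ j *\<^sub>R axis j 1) a"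
      using basis_expansion[of \<xi>] by (simp add: scalar_mult_eq_scaleR)
    also have "\<dots> = (\<Sum>j\<in>UNIV. f (\<xi> $ j *\<^sub>R axis j 1) a)"
      using linear_sum[OF L] .
    also have "\<dots> = (\<Sum>j\<in>UNIV. \<xi> $ j * f (axis j 1) a)"
      using linear_scale[OF L] by (intro sum.cong refl) simp
    finally show ?thesis .
  qed
  have int: "f v integrable_on ?K" for v by (rule integrable_continuous[OF contf])
  have "integral ?K (f \<xi>) = (\<Sum>j\<in>UNIV. \<xi> $ j * integral ?K (f (axis j 1)))"
    unfolding lin[abs_def] using int by (subst integral_sum) (auto intro: integrable_on_mult_right)
  then have "\<bar>integral ?K (f \<xi>)\<bar> \<le> (\<Sum>j\<in>UNIV. \<bar>\<xi> $ j * integral ?K (f (axis j 1))\<bar>)" by simp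
  also have "\<dots> \<le> (\<Sum>j\<in>(UNIV::'k set). norm \<xi> * (M * ?I))"
    unfolding abs_mult by (intro sum_mono mult_mono Ij component_le_norm_cart) auto
  also have "\<dots> = (CARD('k) * M) * norm \<xi> * ?I" by simp
  finally show ?thesis unfolding f_def .
qed

section \<open>Local intrinsic Lipschitz continuity\<close>

text \<open>
  From \<open>a\<close> the characteristic segment leads to a point over the same \<open>x\<close>-coordinates as \<open>a'\<close>, at a cost
  controlled by \<open>norm \<xi>\<close>; the remaining vertical step is covered by Hoelder continuity. The two costs
  are the two entries of the maximum that defines the homogeneous norm of the displacement.
\<close>

lemma local_intrinsic_estimate:
  fixes B :: "('k::finite, 'n::finite) structure_mats"
  assumes B: "step2_structure B" and \<epsilon>: "0 < \<epsilon>" and C: "0 < C"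
    and w: "w \<in> Linf_loc S" and sol: "distributional_solution B S \<phi> w"
    and hoelder: "vertically_half_hoelder C S \<phi>" and a0: "a0 \<in> S"
  obtains \<rho> L where "0 < \<rho>" "0 \<le> L" "ball a0 \<rho> \<subseteq> S"
    "\<And>a a'. a \<in> ball a0 \<rho> \<Longrightarrow> a' \<in> ball a0 \<rho> \<Longrightarrow>
       \<bar>\<phi> a' - \<phi> a\<bar> \<le> L * hnorm \<epsilon> (emb_W (intrinsic_disp B a (\<phi> a) a'))"
proof -
  from bspec[OF hoelder[unfolded vertically_half_hoelder_def] a0]
  obtain U where U: "open U" "a0 \<in> U" "U \<subseteq> S" and hU': "\<forall>x y y'. (x, y) \<in> U \<longrightarrow> (x, y') \<in> U \<longrightarrow>
      \<bar>\<phi> (x, y) - \<phi> (x, y')\<bar> \<le> C * sqrt (norm (y - y'))"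
    by (elim exE conjE)
  have hU: "\<bar>\<phi> (x, y) - \<phi> (x, y')\<bar> \<le> C * sqrt (norm (y - y'))"
    if "(x, y) \<in> U" "(x, y') \<in> U" for x y y'
    using hU' that by simp
  obtain p q where pq: "a0 \<in> box p q" "cbox p q \<subseteq> U"
    by (rule open_contains_cbox[OF U(1,2)])
  let ?K = "cbox p q"
  obtain R where R: "0 < R" "ball a0 R \<subseteq> box p q"
    using openE[OF open_box pq(1)] .
  have RK: "ball a0 R \<subseteq> ?K" by (rule order_trans[OF R(2) box_subset_cbox])
  have KS: "?K \<subseteq> S" using pq(2) U(3) by blast
  have cont: "continuous_on ?K \<phi>"
    using sol KS continuous_on_subset unfolding distributional_solution_def by blast
  obtain M' where M': "AE a in lebesgue. a \<in> ?K \<longrightarrow> norm (w a) \<le> M'"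
    using w KS unfolding Linf_loc_def mem_Collect_eq by (meson compact_cbox)
  define M where "M = CARD('k) * max M' 0"
  have M: "0 \<le> M" by (simp add: M_def)
  have M0: "AE a in lebesgue. a \<in> ?K \<longrightarrow> norm (w a) \<le> max M' 0"
    using M' by (rule AE_mp) (auto intro!: AE_I2)
  obtain b where b: "0 < b" "\<And>\<xi>. norm (coupling B \<xi>) \<le> b * norm \<xi>"
    using linear_bounded_pos[OF linear_coupling] by blast
  obtain W where W: "0 < W" "\<And>x \<xi>. norm (hform B x \<xi>) \<le> norm x * norm \<xi> * W"
    using bounded_bilinear.pos_bounded[OF bounded_bilinear_hform] by blast
  have "compact (\<phi> ` ?K)" by (rule compact_continuous_image[OF cont compact_cbox])
  then obtain \<Phi> where \<Phi>: "0 < \<Phi>" "\<And>a. a \<in> ?K \<Longrightarrow> \<bar>\<phi> a\<bar> \<le> \<Phi>"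
    using compact_imp_bounded[THEN bounded_pos[THEN iffD1]] by (metis imageI real_norm_def)
  define s where "s = 4 * C * b * (8 * 2 ^ DIM(('k, 'n) param))"
  define Q where "Q = 1 + (norm a0 + 1) * W / 2 + \<Phi> * b"
  \<comment> \<open>Frozen characteristic segments between fibres over the ball have length at most \<open>2 * Q * \<rho>\<close> and bumps around them have
    vertical radius at most \<open>4 * s\<^sup>2 * \<rho>\<close>; the denominator keeps all of this inside the box on which
    the hypotheses hold uniformly.\<close>
  define \<rho> where "\<rho> = min 1 (R / (4 * (1 + 2 * Q + 4 * s\<^sup>2)))"
  define L0 where "L0 = 9 * C * s + 2 * M + 2"
  have s0: "0 < s" using C b(1) by (simp add: s_def)
  have Q: "0 < Q" using W(1) \<Phi>(1) b(1) by (simp add: Q_def add_pos_nonneg)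
  have L0: "0 \<le> L0" using C s0 M by (simp add: L0_def)
  have den: "0 < 1 + 2 * Q + 4 * s\<^sup>2" using Q s0 by (simp add: add_pos_nonneg)
  have \<rho>: "0 < \<rho>" "\<rho> \<le> 1" using R(1) den by (simp_all add: \<rho>_def)
  have "\<rho> \<le> R / (4 * (1 + 2 * Q + 4 * s\<^sup>2))" by (simp add: \<rho>_def)
  then have "\<rho> * (4 * (1 + 2 * Q + 4 * s\<^sup>2)) \<le> R"
    using den by (simp add: pos_le_divide_eq)
  then have \<rho>R: "\<rho> + 2 * Q * \<rho> + 4 * s\<^sup>2 * \<rho> \<le> R / 4" by (simp add: algebra_simps)
  have "0 \<le> 2 * Q * \<rho>" "0 \<le> 4 * s\<^sup>2 * \<rho>" using Q \<rho> by simp_all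
  then have "\<rho> \<le> R" using \<rho>R \<rho>(1) R(1) by linarith
  then have ballK: "ball a0 \<rho> \<subseteq> ?K" using RK by (meson order_trans subset_ball)
  show thesis
  proof (rule that[of \<rho> "L0 + C / \<epsilon>"])
    show "0 < \<rho>" by fact
    show "0 \<le> L0 + C / \<epsilon>" using L0 C \<epsilon> by simp
    show "ball a0 \<rho> \<subseteq> S" using ballK KS by blast
    fix a a' assume a: "a \<in> ball a0 \<rho>" and a': "a' \<in> ball a0 \<rho>"
    define \<xi> where "\<xi> = fst a' - fst a"
    define Z where "Z = (\<xi>, (1/2) *\<^sub>R hform B (fst a) \<xi> + \<phi> a *\<^sub>R coupling B \<xi>)"
    have da: "norm (a - a0) < \<rho>" "norm (a' - a0) < \<rho>"
      using a a' by (simp_all add: dist_norm norm_minus_commute)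
    have "norm (a' - a) < 2 * \<rho>"
      using norm_triangle_ineq4[of "a' - a0" "a - a0"] da by simp
    moreover have "norm \<xi> \<le> norm (a' - a)"
      using norm_fst_le[of "fst (a' - a)" "snd (a' - a)"] unfolding prod.collapse by (simp add: \<xi>_def)
    ultimately have h: "norm \<xi> \<le> 2 * \<rho>" by simp
    have fa: "norm (fst a) \<le> norm a0 + 1"
      using norm_fst_le[of "fst a" "snd a"] norm_triangle_sub[of a a0] da \<rho>(2) by simp
    have \<phi>a: "\<bar>\<phi> a\<bar> \<le> \<Phi>" using \<Phi>(2) a ballK by blast
    have "norm Z \<le> norm \<xi> + norm ((1/2) *\<^sub>R hform B (fst a) \<xi> + \<phi> a *\<^sub>R coupling B \<xi>)"
      unfolding Z_def by (rule norm_Pair_le)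
    also have "\<dots> \<le> norm \<xi> + ((1/2) * norm (hform B (fst a) \<xi>) + \<bar>\<phi> a\<bar> * norm (coupling B \<xi>))"
      by (intro add_left_mono order_trans[OF norm_triangle_ineq]) simp
    also have "\<dots> \<le> norm \<xi> + ((1/2) * ((norm a0 + 1) * norm \<xi> * W) + \<Phi> * (b * norm \<xi>))"
      using fa W(1) \<phi>a b \<Phi>(1)
      by (intro add_left_mono add_mono mult_left_mono mult_mono order_trans[OF W(2)] mult_right_mono) auto
    also have "\<dots> = Q * norm \<xi>" by (simp add: Q_def algebra_simps)
    also have "\<dots> \<le> Q * (2 * \<rho>)" using Q h by (intro mult_left_mono) auto
    finally have nZ: "norm Z \<le> 2 * Q * \<rho>" by simp
    have tube: "cylinder (R / 2) ((s * norm \<xi>)\<^sup>2) (a + t *\<^sub>R Z) \<subseteq> ?K" if t: "0 \<le> t" "t \<le> 1" for t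
    proof
      fix z assume z: "z \<in> cylinder (R / 2) ((s * norm \<xi>)\<^sup>2) (a + t *\<^sub>R Z)"
      let ?d = "z - (a + t *\<^sub>R Z)"
      have "norm (fst ?d) \<le> R / 2" "norm (snd ?d) \<le> (s * norm \<xi>)\<^sup>2"
        using z by (auto simp: cylinder_def dist_norm norm_minus_commute)
      moreover have "(s * norm \<xi>)\<^sup>2 \<le> 4 * s\<^sup>2 * \<rho>"
      proof -
        have "(s * norm \<xi>)\<^sup>2 \<le> s\<^sup>2 * (2 * \<rho>)\<^sup>2"
          unfolding power_mult_distrib[of s] by (intro mult_left_mono power_mono h) simp_all
        also have "\<dots> = 4 * s\<^sup>2 * (\<rho> * \<rho>)" by (simp add: power2_eq_square)
        also have "\<dots> \<le> 4 * s\<^sup>2 * (\<rho> * 1)" using \<rho> by (intro mult_left_mono) auto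
        finally show ?thesis by simp
      qed
      moreover have "norm ?d \<le> norm (fst ?d) + norm (snd ?d)"
        using norm_Pair_le[of "fst ?d" "snd ?d"] unfolding prod.collapse .
      moreover have "norm (t *\<^sub>R Z) \<le> 2 * Q * \<rho>"
      proof -
        have "norm (t *\<^sub>R Z) \<le> 1 * norm Z" using t unfolding norm_scaleR by (intro mult_right_mono) auto
        then show ?thesis using nZ by simp
      qed
      moreover have "norm (z - a0) \<le> norm ?d + norm (a - a0) + norm (t *\<^sub>R Z)"
      proof -
        have "z - a0 = (?d + (a - a0)) + t *\<^sub>R Z" by simp
        then have "norm (z - a0) \<le> norm (?d + (a - a0)) + norm (t *\<^sub>R Z)"
          by (simp only: norm_triangle_ineq)
        also have "\<dots> \<le> norm ?d + norm (a - a0) + norm (t *\<^sub>R Z)"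
          by (intro add_right_mono norm_triangle_ineq)
        finally show ?thesis .
      qed
      ultimately have "norm (z - a0) < R" using \<rho>R da(1) R(1) by linarith
      then have "z \<in> ball a0 R" by (simp add: dist_norm norm_minus_commute)
      then show "z \<in> ?K" using RK by blast
    qed
    have 1: "\<bar>\<phi> (a + Z) - \<phi> a\<bar> \<le> L0 * norm \<xi>"
      unfolding L0_def Z_def
    proof (rule characteristic_estimate[where \<phi>=\<phi> and \<omega>="hform B" and \<beta>="coupling B" and b=b
          and C=C and M=M and s=s and \<rho>="R/2" and p=p and q=q])
      show "bounded_bilinear (hform B)" by (rule bounded_bilinear_hform)
      show "hform B \<xi> \<xi> = 0" by (rule hform_alternating[OF B])
      show "s = 4 * C * b * (8 * 2 ^ DIM(('k, 'n) param))" by (rule s_def)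
      show "\<bar>integral ?K (\<lambda>a. \<phi> a *
            (bump_grad \<delta> r (a - c) \<bullet> (\<xi>, (1/2) *\<^sub>R hform B (fst a) \<xi> + (\<phi> a / 2) *\<^sub>R coupling B \<xi>)))\<bar>
        \<le> M * norm \<xi> * bump_mass TYPE(('k, 'n) param) \<delta> r"
        if "0 < \<delta>" "0 < r" "cylinder \<delta> r c \<subseteq> ?K" for c \<delta> r
        unfolding M_def by (rule distributional_bump_bound[OF sol KS M0 _ that]) simp
      show "\<bar>\<phi> (x, y) - \<phi> (x, y')\<bar> \<le> C * sqrt (norm (y - y'))"
        if "(x, y) \<in> ?K" "(x, y') \<in> ?K" for x y y'
        using hU that pq(2) by blast
    qed (use b C M R(1) cont tube[unfolded Z_def] in auto)
    have "a + 1 *\<^sub>R Z \<in> ?K"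
      by (rule subsetD[OF tube[of 1]]) (use R(1) in \<open>auto simp: cylinder_def mem_Times_iff\<close>)
    moreover have aZ_eq: "(fst a', snd (a + Z)) = a + Z" by (simp add: Z_def \<xi>_def prod_eq_iff)
    ultimately have aZ: "(fst a', snd (a + Z)) \<in> U" using pq(2) by auto
    have "\<bar>\<phi> (fst a', snd a') - \<phi> (fst a', snd (a + Z))\<bar> \<le> C * sqrt (norm (snd a' - snd (a + Z)))"
      by (rule hU[OF _ aZ]) (use a' ballK pq(2) in auto)
    moreover have "snd a' - snd (a + Z) = snd (intrinsic_disp B a (\<phi> a) a')"
      by (simp add: Z_def \<xi>_def intrinsic_disp_def algebra_simps)
    ultimately have 2: "\<bar>\<phi> a' - \<phi> (a + Z)\<bar> \<le> C * sqrt (norm (snd (intrinsic_disp B a (\<phi> a) a')))"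
      unfolding aZ_eq by simp
    let ?n = "hnorm \<epsilon> (emb_W (intrinsic_disp B a (\<phi> a) a'))"
    have n1: "norm \<xi> \<le> ?n" by (simp add: hnorm_emb_W intrinsic_disp_def \<xi>_def)
    have n2: "sqrt (norm (snd (intrinsic_disp B a (\<phi> a) a'))) \<le> ?n / \<epsilon>"
      using \<epsilon> by (simp add: hnorm_emb_W pos_le_divide_eq mult.commute)
    have "\<bar>\<phi> a' - \<phi> a\<bar> \<le> C * sqrt (norm (snd (intrinsic_disp B a (\<phi> a) a'))) + L0 * norm \<xi>"
      using 1 2 by linarith
    also have "\<dots> \<le> C * (?n / \<epsilon>) + L0 * ?n"
      using C L0 n1 n2 by (intro add_mono mult_left_mono) auto
    also have "\<dots> = (L0 + C / \<epsilon>) * ?n" by (simp add: algebra_simps)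
    finally show "\<bar>\<phi> a' - \<phi> a\<bar> \<le> (L0 + C / \<epsilon>) * ?n" .
  qed
qed

theorem theorem7p2:
  fixes B :: "('k::finite, 'n::finite) structure_mats"
    and \<epsilon> C\<^sub>h :: real
    and Ohat :: "('k, 'n) pt set"
    and \<phi>hat :: "('k, 'n) pt \<Rightarrow> ('k, 'n) pt"
    and \<phi> :: "('k, 'n) param \<Rightarrow> real"
    and w :: "('k, 'n) param \<Rightarrow> real ^ 'k"
  assumes "step2_structure B"
    and "hnorm_const B \<epsilon>"
    and "openin (top_of_set WW) Ohat"
    and "\<phi>hat ` Ohat \<subseteq> VV"
    and "continuous_on Ohat \<phi>hat"
    and "\<forall>a \<in> emb_W -` Ohat. \<phi>hat (emb_W a) = emb_V (\<phi> a)"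
    and "w \<in> Linf_loc (emb_W -` Ohat)"
    and "distributional_solution B (emb_W -` Ohat) \<phi> w"
    and "C\<^sub>h > 0"
    and "vertically_half_hoelder C\<^sub>h (emb_W -` Ohat) \<phi>"
  shows "locally_intrinsic_lipschitz B \<epsilon> Ohat \<phi>hat"
  unfolding locally_intrinsic_lipschitz_def
proof
  fix p assume p: "p \<in> Ohat"
  have \<epsilon>: "0 < \<epsilon>" using assms(2) by (simp add: hnorm_const_def)
  have OW: "Ohat \<subseteq> WW" using assms(3) openin_imp_subset by auto
  then obtain a0 where a0: "p = emb_W a0" using p by (auto simp: WW_def)
  then have "a0 \<in> emb_W -` Ohat" using p by simp
  then obtain \<rho> L where \<rho>: "0 < \<rho>" "0 \<le> L" "ball a0 \<rho> \<subseteq> emb_W -` Ohat"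
    and est: "\<And>a a'. a \<in> ball a0 \<rho> \<Longrightarrow> a' \<in> ball a0 \<rho> \<Longrightarrow>
       \<bar>\<phi> a' - \<phi> a\<bar> \<le> L * hnorm \<epsilon> (emb_W (intrinsic_disp B a (\<phi> a) a'))"
    using local_intrinsic_estimate[OF assms(1) \<epsilon> assms(9,7,8,10)] by blast
  define coord :: "('k, 'n) pt \<Rightarrow> ('k, 'n) param" where
    "coord z = ((\<chi> l. fst z $ Some l), snd z)" for z
  have coord: "coord (emb_W a) = a" for a
    by (simp add: coord_def emb_W_def prod_eq_iff vec_eq_iff)
  have "emb_W ` ball a0 \<rho> = Ohat \<inter> coord -` ball a0 \<rho>"
    using \<rho>(3) OW coord by (force simp: WW_def)
  moreover have "continuous_on Ohat coord"
    unfolding coord_def by (intro continuous_intros)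
  then have "openin (top_of_set Ohat) (Ohat \<inter> coord -` ball a0 \<rho>)"
    by (rule continuous_openin_preimage_gen) simp
  ultimately have "openin (top_of_set Ohat) (emb_W ` ball a0 \<rho>)" by simp
  moreover have "p \<in> emb_W ` ball a0 \<rho>" using a0 \<rho>(1) by simp
  moreover have "intrinsic_lipschitz_with B \<epsilon> L (emb_W ` ball a0 \<rho>) \<phi>hat"
    by (rule intrinsic_lipschitz_criterion[OF assms(1) \<epsilon> \<rho>(2), where \<phi>=\<phi>])
       (use assms(6) \<rho>(3) est in \<open>blast+\<close>)
  ultimately show "\<exists>U. openin (top_of_set Ohat) U \<and> p \<in> U \<and> (\<exists>L. intrinsic_lipschitz_with B \<epsilon> L U \<phi>hat)"
    by blast
qed

end
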